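(* Let $\mathcal I$ be a maximal ideal on $\omega$ and let $\dot{\mathbb Q}$ be a $\mathbb P(\mathcal I)$-name for a forcing notion such that the two-step iteration $\mathbb P(\mathcal I)\ast\dot{\mathbb Q}$ has the Weak Sacks Property. Suppose $(\tau,p)\in\mathbb P(\mathcal I)\ast\dot{\mathbb Q}$ and $(\tau,p)\Vdash\dot Z\subseteq 2^\omega$ is nowhere dense. Then there are $(\sigma,q)\le(\tau,p)$ and $U\in\mathcal I^*$ such that $(\sigma,q)\Vdash F_{\dot G}[U]\cap\dot Z=\varnothing$, where $\dot G$ is the name for the $\mathbb P(\mathcal I)$-generic filter.
   Context: For an ideal $\mathcal I$ on $\omega$, $\mathbb P(\mathcal I)$ consists of all functions $\sigma$ with domain $\omega$ for which there is $d:\omega\to\omega$ such that for every $n\in\omega$: $d(n)\le n$, $\sigma(n)$ is a function from the interval $[d(n),n)$ to $2=\{0,1\}$, and $d^{-1}(\{n\})\in\mathcal I$. This $d$ is determined by $\sigma$ and denoted $d_\sigma$. For $\sigma,\tau\in\mathbb P(\mathcal I)$, $\sigma\le\tau$ means: (i) $\sigma(n)\supseteq\tau(n)$ for all $n$; (ii) there is $e:\omega\to\omega$ with $e(n)\le n$ for all $n$ and $d_\sigma=e\circ d_\tau$; (iii) whenever $d_\tau(n)=d_\tau(m)$, $\sigma(n)\restriction[d_\sigma(n),d_\tau(n))=\sigma(m)\restriction[d_\sigma(n),d_\tau(n))$. For a generic $G\subseteq\mathbb P(\mathcal I)$, $F_G:\omega\to 2^\omega$ is defined by $F_G(n)(j)=\left(\bigcup_{\sigma\in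 G}\sigma(n)\right)(j)$ if $j<n$ and $F_G(n)(j)=0$ if $j\ge n$. $\mathcal I^*=\{\omega\setminus A:A\in\mathcal I\}$ is the dual filter. A forcing notion $\mathbb P$ has the Weak Sacks Property if whenever $p\Vdash_{\mathbb P}\dot f:\omega\to\omega$ and $g:\omega\to\omega$ with $\lim_{n\to\infty}g(n)=\infty$, there are $q\le p$, $F\in\prod_n[\omega]^{g(n)}$ and an infinite $A\subseteq\omega$ such that $q\Vdash_{\mathbb P}(\forall n\in A)\ \dot f(n)\in F(n)$. *)

theory Defs
  imports Complex_Main "HOL-Library.Nat_Bijection"
begin

section \<open>Names and the forcing relation\<close>

text \<open>
  A forcing notion is a nonempty preorder, given as a relation \<open>R\<close> with
  \<open>(q, p) \<in> R\<close> meaning that \<open>q\<close> is stronger than \<open>p\<close>; its conditions are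
  \<open>Field R\<close>. No largest condition is required.

  A name is a set of pairs (name, condition). HOL has no datatype of all such
  sets, so a name is a family indexed by part of \<open>nat + 'i\<close>: an entry \<open>Some (y, A)\<close> contributes
  the pairs \<open>(y, p)\<close> with \<open>p \<in> A\<close>. Every set-sized name is represented once the type \<open>'i\<close> is
  large enough, so statements about all names have to be made with \<open>'i\<close> as a type
  variable. The summand \<open>nat\<close> guarantees that the universe of names contains the canonical
  names used below and names for all reals, whatever \<open>'i\<close> is.
\<close>

datatype ('p, 'i) name = Name (entries: "nat + 'i \<Rightarrow> (('p, 'i) name \<times> 'p set) option")

definition elts :: "('p, 'i) name \<Rightarrow> (('p, 'i) name \<times> 'p) set" where
  "elts x = {(y, p). \<exists>i A. entries x i = Some (y, A) \<and> p \<in> A}"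

inductive is_name :: "'p rel \<Rightarrow> ('p, 'i) name \<Rightarrow> bool" for R where
  "(\<And>i y A. entries x i = Some (y, A) \<Longrightarrow> is_name R y \<and> A \<subseteq> Field R) \<Longrightarrow> is_name R x"

lemma wf_elts: "wf {(y, x). \<exists>s. (y, s) \<in> elts x}"
proof (rule wfUNIVI)
  fix P :: "('a, 'b) name \<Rightarrow> bool" and x
  assume *: "\<forall>x. (\<forall>y. (y, x) \<in> {(y, x). \<exists>s. (y, s) \<in> elts x} \<longrightarrow> P y) \<longrightarrow> P x"
  show "P x"
  proof (induction x)
    case (Name f)
    have "P y" if "f i = Some (y, A)" for y i A
      using Name[of "f i" "(y, A)" y] that by (auto intro: rangeI[of f i, simplified that])
    then have "P y" if "(y, s) \<in> elts (Name f)" for y s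
      using that by (auto simp: elts_def)
    then show ?case
      using * by blast
  qed
qed

text \<open>
  \<open>forces_eq R x y p\<close> is \<open>p \<tturnstile> x = y\<close>: every element of either name is forced to
  belong to the other one, where \<open>z \<in> y\<close> is forced if densely often some \<open>(w, t)\<close> in \<open>y\<close> has
  its condition \<open>t\<close> in the generic filter and \<open>z = w\<close>.
\<close>

function forces_eq :: "'p rel \<Rightarrow> ('p, 'i) name \<Rightarrow> ('p, 'i) name \<Rightarrow> 'p \<Rightarrow> bool" where
  "forces_eq R x y p \<longleftrightarrow>
     (\<forall>zs\<in>elts x. \<forall>q. (q, p) \<in> R \<and> (q, snd zs) \<in> R \<longrightarrow>
        (\<exists>wt\<in>elts y. \<exists>r. (r, q) \<in> R \<and> (r, snd wt) \<in> R \<and> forces_eq R (fst zs) (fst wt) r)) \<and>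
     (\<forall>wt\<in>elts y. \<forall>q. (q, p) \<in> R \<and> (q, snd wt) \<in> R \<longrightarrow>
        (\<exists>zs\<in>elts x. \<exists>r. (r, q) \<in> R \<and> (r, snd zs) \<in> R \<and> forces_eq R (fst zs) (fst wt) r))"
  by pat_completeness auto
termination
  by (relation "inv_image {(y, x). \<exists>s. (y, s) \<in> elts x} (\<lambda>(R, x, y, p). x)")
     (auto intro: wf_elts)

definition forces_mem :: "'p rel \<Rightarrow> ('p, 'i) name \<Rightarrow> ('p, 'i) name \<Rightarrow> 'p \<Rightarrow> bool" where
  "forces_mem R x y p \<longleftrightarrow>
     (\<forall>q. (q, p) \<in> R \<longrightarrow> (\<exists>(w, t)\<in>elts y. \<exists>r. (r, q) \<in> R \<and> (r, t) \<in> R \<and> forces_eq R x w r))"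

text \<open>
  The forcing language. \<open>Forall\<close> quantifies over the names; \<open>ForallN A\<close> quantifies over the elements of
  a ground model set \<open>A \<subseteq> \<omega>\<close>.
\<close>

datatype ('p, 'i) fm =
    Eq "('p, 'i) name" "('p, 'i) name"
  | Mem "('p, 'i) name" "('p, 'i) name"
  | Neg "('p, 'i) fm"
  | Conj "('p, 'i) fm" "('p, 'i) fm"
  | Forall "('p, 'i) name \<Rightarrow> ('p, 'i) fm"
  | ForallN "nat set" "nat \<Rightarrow> ('p, 'i) fm"

primrec forces :: "'p rel \<Rightarrow> 'p \<Rightarrow> ('p, 'i) fm \<Rightarrow> bool" where
  "forces R p (Eq x y) \<longleftrightarrow> forces_eq R x y p"
| "forces R p (Mem x y) \<longleftrightarrow> forces_mem R x y p"
| "forces R p (Neg \<phi>) \<longleftrightarrow> (\<forall>q. (q, p) \<in> R \<longrightarrow> \<not> forces R q \<phi>)"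
| "forces R p (Conj \<phi> \<psi>) \<longleftrightarrow> forces R p \<phi> \<and> forces R p \<psi>"
| "forces R p (Forall \<phi>) \<longleftrightarrow> (\<forall>x. is_name R x \<longrightarrow> forces R p (\<phi> x))"
| "forces R p (ForallN A \<psi>) \<longleftrightarrow> (\<forall>n. n \<in> A \<longrightarrow> forces R p (\<psi> n))"

definition Imp :: "('p, 'i) fm \<Rightarrow> ('p, 'i) fm \<Rightarrow> ('p, 'i) fm" where
  "Imp \<phi> \<psi> = Neg (Conj \<phi> (Neg \<psi>))"

definition Iff :: "('p, 'i) fm \<Rightarrow> ('p, 'i) fm \<Rightarrow> ('p, 'i) fm" where
  "Iff \<phi> \<psi> = Conj (Imp \<phi> \<psi>) (Imp \<psi> \<phi>)"

definition Exists :: "(('p, 'i) name \<Rightarrow> ('p, 'i) fm) \<Rightarrow> ('p, 'i) fm" where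
  "Exists \<phi> = Neg (Forall (\<lambda>x. Neg (\<phi> x)))"

definition Forall_in :: "('p, 'i) name \<Rightarrow> (('p, 'i) name \<Rightarrow> ('p, 'i) fm) \<Rightarrow> ('p, 'i) fm" where
  "Forall_in x \<phi> = Forall (\<lambda>y. Imp (Mem y x) (\<phi> y))"

definition Exists_in :: "('p, 'i) name \<Rightarrow> (('p, 'i) name \<Rightarrow> ('p, 'i) fm) \<Rightarrow> ('p, 'i) fm" where
  "Exists_in x \<phi> = Exists (\<lambda>y. Conj (Mem y x) (\<phi> y))"


section \<open>Canonical names\<close>

definition seq_name :: "'p rel \<Rightarrow> (nat \<Rightarrow> ('p, 'i) name option) \<Rightarrow> ('p, 'i) name" where
  "seq_name R X = Name (\<lambda>i. case i of
       Inl k \<Rightarrow> map_option (\<lambda>x. (x, Field R)) (X k)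
     | Inr _ \<Rightarrow> None)"

text \<open>Check names of von Neumann numerals and of subsets of \<open>\<omega>\<close>.\<close>

function chk :: "'p rel \<Rightarrow> nat \<Rightarrow> ('p, 'i) name" where
  "chk R n = seq_name R (\<lambda>k. if k < n then Some (chk R k) else None)"
  by pat_completeness auto
termination by (relation "measure snd") auto

definition chk_set :: "'p rel \<Rightarrow> nat set \<Rightarrow> ('p, 'i) name" where
  "chk_set R A = seq_name R (\<lambda>k. if k \<in> A then Some (chk R k) else None)"

abbreviation omega :: "'p rel \<Rightarrow> ('p, 'i) name" where
  "omega R \<equiv> chk_set R UNIV"

definition upair :: "'p rel \<Rightarrow> ('p, 'i) name \<Rightarrow> ('p, 'i) name \<Rightarrow> ('p, 'i) name" where
  "upair R x y = seq_name R (\<lambda>k. if k = 0 then Some x else if k = 1 then Some y else None)"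

definition opair :: "'p rel \<Rightarrow> ('p, 'i) name \<Rightarrow> ('p, 'i) name \<Rightarrow> ('p, 'i) name" where
  "opair R x y = upair R (upair R x x) (upair R x y)"

declare forces_eq.simps [simp del] chk.simps [simp del]


section \<open>Formulas about functions and reals\<close>

text \<open>\<open>f : A \<rightarrow> B\<close>\<close>
definition fun_fm ::
    "'p rel \<Rightarrow> ('p, 'i) name \<Rightarrow> ('p, 'i) name \<Rightarrow> ('p, 'i) name \<Rightarrow> ('p, 'i) fm" where
  "fun_fm R f A B =
     Conj (Forall_in f (\<lambda>z. Exists_in A (\<lambda>x. Exists_in B (\<lambda>y. Eq z (opair R x y)))))
    (Conj (Forall_in A (\<lambda>x. Exists_in B (\<lambda>y. Mem (opair R x y) f)))
          (Forall_in A (\<lambda>x. Forall_in B (\<lambda>y. Forall_in B (\<lambda>y'.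
             Imp (Conj (Mem (opair R x y) f) (Mem (opair R x y') f)) (Eq y y'))))))"

text \<open>\<open>x \<in> 2\<^sup>\<omega>\<close>, with \<open>2 = {0, 1}\<close>\<close>
definition real_fm :: "'p rel \<Rightarrow> ('p, 'i) name \<Rightarrow> ('p, 'i) fm" where
  "real_fm R x = fun_fm R x (omega R) (chk R 2)"

text \<open>\<open>x\<close> and \<open>y\<close> have the same restriction to \<open>n\<close>, i.e. \<open>y\<close> lies in the \<open>n\<close>-th basic
  neighbourhood of \<open>x\<close> in \<open>2\<^sup>\<omega>\<close>.\<close>
definition agree_fm :: "'p rel \<Rightarrow> nat \<Rightarrow> ('p, 'i) name \<Rightarrow> ('p, 'i) name \<Rightarrow> ('p, 'i) fm" where
  "agree_fm R n x y = ForallN {..<n} (\<lambda>k. Forall_in (chk R 2) (\<lambda>b.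
     Iff (Mem (opair R (chk R k) b) x) (Mem (opair R (chk R k) b) y)))"

text \<open>\<open>x\<close> is in the closure of \<open>Z\<close>\<close>
definition closure_fm :: "'p rel \<Rightarrow> ('p, 'i) name \<Rightarrow> ('p, 'i) name \<Rightarrow> ('p, 'i) fm" where
  "closure_fm R Z x = ForallN UNIV (\<lambda>n. Exists_in Z (\<lambda>z. agree_fm R n x z))"

text \<open>\<open>Z \<subseteq> 2\<^sup>\<omega>\<close>, and no \<open>x \<in> 2\<^sup>\<omega>\<close> is an interior point of the closure of \<open>Z\<close>\<close>
definition nowhere_dense_fm :: "'p rel \<Rightarrow> ('p, 'i) name \<Rightarrow> ('p, 'i) fm" where
  "nowhere_dense_fm R Z =
     Conj (Forall_in Z (\<lambda>z. real_fm R z))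
          (Forall (\<lambda>x. Imp (real_fm R x) (ForallN UNIV (\<lambda>n. Neg (Forall (\<lambda>y.
             Imp (Conj (real_fm R y) (agree_fm R n x y)) (closure_fm R Z y)))))))"


section \<open>The Weak Sacks Property\<close>

text \<open>The type argument fixes the universe of names. It is immaterial up to equivalence: every
  function from \<open>\<omega>\<close> to \<open>\<omega>\<close> has a name with countably many entries.\<close>

definition weak_sacks :: "'i itself \<Rightarrow> 'p rel \<Rightarrow> bool" where
  "weak_sacks _ R \<longleftrightarrow>
     (\<forall>p \<in> Field R. \<forall>(f :: ('p, 'i) name) (g :: nat \<Rightarrow> nat).
        is_name R f \<and> forces R p (fun_fm R f (omega R) (omega R)) \<and>
        filterlim g at_top sequentially \<longrightarrow>
        (\<exists>q F A. (q, p) \<in> R \<and> (\<forall>n. finite (F n) \<and> card (F n) = g n) \<and> infinite A \<and>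
           forces R q (ForallN A (\<lambda>n. Exists_in (chk_set R (F n)) (\<lambda>m. Mem (opair R (chk R n) m) f)))))"


section \<open>Two-step iterations\<close>

text \<open>\<open>(Q, L)\<close> is a nonempty preorder\<close>
definition forcing_notion_fm :: "'p rel \<Rightarrow> ('p, 'i) name \<Rightarrow> ('p, 'i) name \<Rightarrow> ('p, 'i) fm" where
  "forcing_notion_fm R Q L =
     Conj (Exists (\<lambda>x. Mem x Q))
    (Conj (Forall_in L (\<lambda>z. Exists_in Q (\<lambda>x. Exists_in Q (\<lambda>y. Eq z (opair R x y)))))
    (Conj (Forall_in Q (\<lambda>x. Mem (opair R x x) L))
          (Forall_in Q (\<lambda>x. Forall_in Q (\<lambda>y. Forall_in Q (\<lambda>z.
             Imp (Conj (Mem (opair R x y) L) (Mem (opair R y z) L)) (Mem (opair R x z) L)))))))"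

definition forcing_notion_name :: "'p rel \<Rightarrow> ('p, 'i) name \<Rightarrow> ('p, 'i) name \<Rightarrow> bool" where
  "forcing_notion_name R Q L \<longleftrightarrow> is_name R Q \<and> is_name R L \<and>
     (\<forall>p \<in> Field R. forces R p (forcing_notion_fm R Q L))"

text \<open>The conditions are the pairs \<open>(p, x)\<close> with \<open>p \<in> P\<close>, \<open>x \<in> dom Q\<close> and \<open>p \<tturnstile> x \<in> Q\<close>. They
  form the field of the following relation if \<open>P\<close> is a preorder and \<open>forcing_notion_name P Q L\<close>.\<close>

definition two_step_conds :: "'p rel \<Rightarrow> ('p, 'i) name \<Rightarrow> ('p \<times> ('p, 'i) name) set" where
  "two_step_conds P Q = {(p, x). p \<in> Field P \<and> x \<in> fst ` elts Q \<and> forces P p (Mem x Q)}"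

definition two_step ::
    "'p rel \<Rightarrow> ('p, 'i) name \<Rightarrow> ('p, 'i) name \<Rightarrow> ('p \<times> ('p, 'i) name) rel" where
  "two_step P Q L = {((p', x'), (p, x)).
     (p', x') \<in> two_step_conds P Q \<and> (p, x) \<in> two_step_conds P Q \<and>
     (p', p) \<in> P \<and> forces P p' (Mem (opair P x' x) L)}"


section \<open>The forcing notion of an ideal\<close>

text \<open>Ideals are proper; they are not required to contain the finite sets. If some \<open>{k}\<close> is not
  in \<open>I\<close>, then the forcing notion below has no conditions, so principal maximal ideals are a
  degenerate case.\<close>

definition ideal_on_omega :: "nat set set \<Rightarrow> bool" where
  "ideal_on_omega I \<longleftrightarrow> {} \<in> I \<and> UNIV \<notin> I \<and> (\<forall>A\<in>I. \<forall>B. B \<subseteq> A \<longrightarrow> B \<in> I) \<and>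
     (\<forall>A\<in>I. \<forall>B\<in>I. A \<union> B \<in> I)"

definition maximal_ideal_on_omega :: "nat set set \<Rightarrow> bool" where
  "maximal_ideal_on_omega I \<longleftrightarrow> ideal_on_omega I \<and>
     (\<forall>J. ideal_on_omega J \<and> I \<subseteq> J \<longrightarrow> J = I)"

definition dual_filter :: "nat set set \<Rightarrow> nat set set" where
  "dual_filter I = {UNIV - A |A. A \<in> I}"

type_synonym cond = "nat \<Rightarrow> nat \<rightharpoonup> bool"

definition ideal_conds :: "nat set set \<Rightarrow> cond set" where
  "ideal_conds I = {\<sigma>. \<exists>d. \<forall>n. d n \<le> n \<and> dom (\<sigma> n) = {d n..<n} \<and> d -` {n} \<in> I}"

definition d_of :: "cond \<Rightarrow> nat \<Rightarrow> nat" where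
  "d_of \<sigma> = (THE d. \<forall>n. d n \<le> n \<and> dom (\<sigma> n) = {d n..<n})"

definition ideal_forcing :: "nat set set \<Rightarrow> cond rel" where
  "ideal_forcing I = {(\<sigma>, \<tau>). \<sigma> \<in> ideal_conds I \<and> \<tau> \<in> ideal_conds I \<and>
     (\<forall>n. \<tau> n \<subseteq>\<^sub>m \<sigma> n) \<and>
     (\<exists>e. (\<forall>n. e n \<le> n) \<and> d_of \<sigma> = e \<circ> d_of \<tau>) \<and>
     (\<forall>n m. d_of \<tau> n = d_of \<tau> m \<longrightarrow>
        \<sigma> n |` {d_of \<sigma> n..<d_of \<tau> n} = \<sigma> m |` {d_of \<sigma> n..<d_of \<tau> n})}"

text \<open>
  If \<open>G\<close> is generic for an iteration \<open>R\<close> whose first step is \<open>ideal_forcing I\<close>, then the induced generic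
  filter for \<open>ideal_forcing I\<close> consists of the first components of the elements of \<open>G\<close>. Hence the
  following is a name for the real \<open>F\<^sub>G(n)\<close>: the entry with index \<open>prod_encode (j, v)\<close>
  puts \<open>(j, v)\<close> into the real if \<open>G\<close> contains a pair \<open>(\<sigma>, x)\<close> with \<open>\<sigma>(n)(j) = v\<close> (where \<open>j < n\<close>),
  and for \<open>j \<ge> n\<close> it puts \<open>(j, 0)\<close> into the real outright.
\<close>

definition FG_name :: "(cond \<times> 'q) rel \<Rightarrow> nat \<Rightarrow> (cond \<times> 'q, 'i) name" where
  "FG_name R n = Name (\<lambda>i. case i of
       Inl k \<Rightarrow> (let (j, v) = prod_decode k in
         Some (opair R (chk R j) (chk R v),
           {p \<in> Field R. if j < n then map_option of_bool (fst p n j) = Some v else v = 0}))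
     | Inr _ \<Rightarrow> None)"

text \<open>\<open>F\<^sub>G[U] \<inter> Z = \<emptyset>\<close>\<close>
definition FG_disjoint_fm ::
    "(cond \<times> 'q) rel \<Rightarrow> nat set \<Rightarrow> (cond \<times> 'q, 'i) name \<Rightarrow> (cond \<times> 'q, 'i) fm" where
  "FG_disjoint_fm R U Z = ForallN U (\<lambda>n. Neg (Mem (FG_name R n) Z))"

end

theory Submission
  imports Defs "HOL-Library.Countable"
begin

text \<open>
  In the extension there is, for every \<open>n\<close>, a block \<open>s : [n, m) \<rightarrow> 2\<close> such that no element of \<open>Z\<close>
  extends \<open>s\<close>: run through the finitely many \<open>t \<in> 2\<^sup>n\<close> and extend \<open>s\<close> each time to avoid \<open>Z\<close>
  above \<open>t\<close>. Let \<open>f(n)\<close> code \<open>n\<close> consecutive blocks of this kind, the first starting at \<open>n\<close>. The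
  Weak Sacks Property leaves at most \<open>n\<close> candidates for \<open>f(n)\<close> when \<open>n\<close> is in an infinite ground
  model set \<open>A\<close>, and \<open>n\<close> sequences of \<open>n\<close> blocks can be merged into a single ground model block
  \<open>s\<^sub>n\<close> that contains a block of each sequence. So \<open>s\<^sub>n\<close> avoids \<open>Z\<close> for \<open>n \<in> A\<close>.

  Now extend the first coordinate from \<open>\<tau>\<close> to \<open>\<sigma>\<close> with \<open>d\<^sub>\<sigma> = e \<circ> d\<^sub>\<tau>\<close>, where \<open>e(j)\<close> is the largest
  \<open>a \<in> A\<close> whose block \<open>s\<^sub>a\<close> ends by \<open>j\<close>, and let \<open>\<sigma>(n)\<close> contain the block \<open>s\<^sub>a\<close> with \<open>a = d\<^sub>\<sigma>(n)\<close>. The map \<open>e\<close> is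
  finite-to-one, so the fibres of \<open>d\<^sub>\<sigma>\<close> stay in the ideal, and \<open>e\<close> fails to find a block only on
  finitely many \<open>j\<close>, that is, on a set of \<open>n\<close> in the ideal.
\<close>

section \<open>The forcing relation of a preorder\<close>

locale forcing_preorder =
  fixes R :: "'p rel"
  assumes refl: "p \<in> Field R \<Longrightarrow> (p, p) \<in> R"
    and trans: "(r, q) \<in> R \<Longrightarrow> (q, p) \<in> R \<Longrightarrow> (r, p) \<in> R"
begin

lemma refl_left: "(q, p) \<in> R \<Longrightarrow> (q, q) \<in> R"
  by (auto intro: refl FieldI1)

lemma forces_eq_iff:
  "forces_eq R x y p \<longleftrightarrow>
     (\<forall>z s q. (z, s) \<in> elts x \<longrightarrow> (q, p) \<in> R \<longrightarrow> (q, s) \<in> R \<longrightarrow>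
        (\<exists>w t r. (w, t) \<in> elts y \<and> (r, q) \<in> R \<and> (r, t) \<in> R \<and> forces_eq R z w r)) \<and>
     (\<forall>w t q. (w, t) \<in> elts y \<longrightarrow> (q, p) \<in> R \<longrightarrow> (q, t) \<in> R \<longrightarrow>
        (\<exists>z s r. (z, s) \<in> elts x \<and> (r, q) \<in> R \<and> (r, s) \<in> R \<and> forces_eq R z w r))"
  by (subst forces_eq.simps)
    (simp only: Ball_def Bex_def split_paired_All split_paired_Ex fst_conv snd_conv, blast)

lemmas forces_eqI = iffD2[OF forces_eq_iff, OF conjI, rule_format]

lemma forces_eq_elts:
  assumes "forces_eq R x y p" "(z, s) \<in> elts x" "(q, p) \<in> R" "(q, s) \<in> R"
  obtains w t r where "(w, t) \<in> elts y" "(r, q) \<in> R" "(r, t) \<in> R" "forces_eq R z w r"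
  using assms(2-) assms(1)[unfolded forces_eq_iff[of x]] by blast

lemma forces_eq_elts':
  assumes "forces_eq R x y p" "(w, t) \<in> elts y" "(q, p) \<in> R" "(q, t) \<in> R"
  obtains z s r where "(z, s) \<in> elts x" "(r, q) \<in> R" "(r, s) \<in> R" "forces_eq R z w r"
  using assms(2-) assms(1)[unfolded forces_eq_iff[of x]] by blast

lemma forces_eq_mono:
  assumes "forces_eq R x y p" "(q, p) \<in> R"
  shows "forces_eq R x y q"
proof (rule forces_eqI)
  fix z s r assume "(z, s) \<in> elts x" "(r, q) \<in> R" "(r, s) \<in> R"
  then show "\<exists>w t r'. (w, t) \<in> elts y \<and> (r', r) \<in> R \<and> (r', t) \<in> R \<and> forces_eq R z w r'"
    using assms by (blast intro: trans elim: forces_eq_elts)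
next
  fix w t r assume "(w, t) \<in> elts y" "(r, q) \<in> R" "(r, t) \<in> R"
  then show "\<exists>z s r'. (z, s) \<in> elts x \<and> (r', r) \<in> R \<and> (r', s) \<in> R \<and> forces_eq R z w r'"
    using assms by (blast intro: trans elim: forces_eq_elts')
qed

lemma name_induct [case_names elts]:
  assumes "\<And>x. (\<And>y s. (y, s) \<in> elts x \<Longrightarrow> P y) \<Longrightarrow> P x"
  shows "P x"
  using wf_elts by (rule wf_induct_rule) (use assms in blast)

lemma forces_eq_refl: "forces_eq R x x p"
proof (induction x arbitrary: p rule: name_induct)
  case (elts x)
  then show ?case by (blast intro: forces_eqI refl_left)
qed

lemma forces_eq_sym: "forces_eq R x y p \<Longrightarrow> forces_eq R y x p"
proof (induction x arbitrary: y p rule: name_induct)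
  case (elts x)
  show ?case
  proof (rule forces_eqI)
    fix w t q assume *: "(w, t) \<in> elts y" "(q, p) \<in> R" "(q, t) \<in> R"
    obtain z s r where "(z, s) \<in> elts x" "(r, q) \<in> R" "(r, s) \<in> R" "forces_eq R z w r"
      by (rule forces_eq_elts'[OF elts.prems *])
    with elts.IH show "\<exists>z s r. (z, s) \<in> elts x \<and> (r, q) \<in> R \<and> (r, s) \<in> R \<and> forces_eq R w z r"
      by blast
  next
    fix z s q assume *: "(z, s) \<in> elts x" "(q, p) \<in> R" "(q, s) \<in> R"
    obtain w t r where "(w, t) \<in> elts y" "(r, q) \<in> R" "(r, t) \<in> R" "forces_eq R z w r"
      by (rule forces_eq_elts[OF elts.prems *])
    with elts.IH[OF *(1)] show "\<exists>w t r. (w, t) \<in> elts y \<and> (r, q) \<in> R \<and> (r, t) \<in> R \<and> forces_eq R w z r"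
      by blast
  qed
qed

lemma forces_eq_trans: "forces_eq R x y p \<Longrightarrow> forces_eq R y z p \<Longrightarrow> forces_eq R x z p"
proof (induction x arbitrary: y z p rule: name_induct)
  case (elts x)
  show ?case
  proof (rule forces_eqI)
    fix u s q assume u: "(u, s) \<in> elts x" "(q, p) \<in> R" "(q, s) \<in> R"
    obtain v t r where v: "(v, t) \<in> elts y" "(r, q) \<in> R" "(r, t) \<in> R" "forces_eq R u v r"
      by (rule forces_eq_elts[OF elts.prems(1) u])
    obtain w t' r' where w: "(w, t') \<in> elts z" "(r', r) \<in> R" "(r', t') \<in> R" "forces_eq R v w r'"
      by (rule forces_eq_elts[OF elts.prems(2) v(1) trans[OF v(2) u(2)] v(3)])
    have "forces_eq R u w r'"
      by (rule elts.IH[OF u(1) forces_eq_mono[OF v(4) w(2)] w(4)])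
    then show "\<exists>w t r. (w, t) \<in> elts z \<and> (r, q) \<in> R \<and> (r, t) \<in> R \<and> forces_eq R u w r"
      using w(1,3) trans[OF w(2) v(2)] by blast
  next
    fix w s q assume w: "(w, s) \<in> elts z" "(q, p) \<in> R" "(q, s) \<in> R"
    obtain v t r where v: "(v, t) \<in> elts y" "(r, q) \<in> R" "(r, t) \<in> R" "forces_eq R v w r"
      by (rule forces_eq_elts'[OF elts.prems(2) w])
    obtain u t' r' where u: "(u, t') \<in> elts x" "(r', r) \<in> R" "(r', t') \<in> R" "forces_eq R u v r'"
      by (rule forces_eq_elts'[OF elts.prems(1) v(1) trans[OF v(2) w(2)] v(3)])
    have "forces_eq R u w r'"
      by (rule elts.IH[OF u(1) u(4) forces_eq_mono[OF v(4) u(2)]])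
    then show "\<exists>u t r. (u, t) \<in> elts x \<and> (r, q) \<in> R \<and> (r, t) \<in> R \<and> forces_eq R u w r"
      using u(1,3) trans[OF u(2) v(2)] by blast
  qed
qed

text \<open>The clauses of \<open>forces_eq\<close> ask for a witness only below some extension of
  the given condition, so it is enough to move into the dense set first and to look for the witness
  there.\<close>

lemma forces_eq_regular:
  assumes "\<And>q. (q, p) \<in> R \<Longrightarrow> \<exists>r. (r, q) \<in> R \<and> forces_eq R x y r"
  shows "forces_eq R x y p"
proof (rule forces_eqI)
  fix z s q assume z: "(z, s) \<in> elts x" "(q, p) \<in> R" "(q, s) \<in> R"
  obtain r where r: "(r, q) \<in> R" "forces_eq R x y r"
    using assms[OF z(2)] by blast
  obtain w t r' where "(w, t) \<in> elts y" "(r', r) \<in> R" "(r', t) \<in> R" "forces_eq R z w r'"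
    by (rule forces_eq_elts[OF r(2) z(1) refl_left[OF r(1)] trans[OF r(1) z(3)]])
  then show "\<exists>w t r. (w, t) \<in> elts y \<and> (r, q) \<in> R \<and> (r, t) \<in> R \<and> forces_eq R z w r"
    using trans[OF _ r(1)] by blast
next
  fix w t q assume w: "(w, t) \<in> elts y" "(q, p) \<in> R" "(q, t) \<in> R"
  obtain r where r: "(r, q) \<in> R" "forces_eq R x y r"
    using assms[OF w(2)] by blast
  obtain z s r' where "(z, s) \<in> elts x" "(r', r) \<in> R" "(r', s) \<in> R" "forces_eq R z w r'"
    by (rule forces_eq_elts'[OF r(2) w(1) refl_left[OF r(1)] trans[OF r(1) w(3)]])
  then show "\<exists>z s r. (z, s) \<in> elts x \<and> (r, q) \<in> R \<and> (r, s) \<in> R \<and> forces_eq R z w r"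
    using trans[OF _ r(1)] by blast
qed

lemma forces_mem_iff:
  "forces_mem R x y p \<longleftrightarrow> (\<forall>q. (q, p) \<in> R \<longrightarrow>
     (\<exists>w t r. (w, t) \<in> elts y \<and> (r, q) \<in> R \<and> (r, t) \<in> R \<and> forces_eq R x w r))"
  unfolding forces_mem_def by fastforce

lemma forces_memE:
  assumes "forces_mem R x y p" "(q, p) \<in> R"
  obtains w t r where "(w, t) \<in> elts y" "(r, q) \<in> R" "(r, t) \<in> R" "forces_eq R x w r"
  using assms unfolding forces_mem_iff by blast

lemma forces_mem_mono: "forces_mem R x y p \<Longrightarrow> (q, p) \<in> R \<Longrightarrow> forces_mem R x y q"
  unfolding forces_mem_iff by (blast intro: trans)

lemma forces_mem_regular:
  assumes "\<And>q. (q, p) \<in> R \<Longrightarrow> \<exists>r. (r, q) \<in> R \<and> forces_mem R x y r"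
  shows "forces_mem R x y p"
  unfolding forces_mem_iff
proof (intro allI impI)
  fix q assume "(q, p) \<in> R"
  then obtain r where r: "(r, q) \<in> R" "forces_mem R x y r"
    using assms by blast
  obtain w t r' where "(w, t) \<in> elts y" "(r', r) \<in> R" "(r', t) \<in> R" "forces_eq R x w r'"
    by (rule forces_memE[OF r(2) refl_left[OF r(1)]])
  then show "\<exists>w t r. (w, t) \<in> elts y \<and> (r, q) \<in> R \<and> (r, t) \<in> R \<and> forces_eq R x w r"
    using trans[OF _ r(1)] by blast
qed

lemma forces_mem_elts:
  assumes "(w, t) \<in> elts y" "(p, t) \<in> R"
  shows "forces_mem R w y p"
  unfolding forces_mem_iff
  using assms(1) trans[OF _ assms(2)] refl_left forces_eq_refl by blast

lemma forces_mem_cong_left: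
  assumes "forces_mem R x y p" "forces_eq R x x' p"
  shows "forces_mem R x' y p"
  unfolding forces_mem_iff
proof (intro allI impI)
  fix q assume q: "(q, p) \<in> R"
  obtain w t r where w: "(w, t) \<in> elts y" "(r, q) \<in> R" "(r, t) \<in> R" "forces_eq R x w r"
    by (rule forces_memE[OF assms(1) q])
  have "forces_eq R x' w r"
    by (rule forces_eq_trans[OF forces_eq_sym[OF forces_eq_mono[OF assms(2) trans[OF w(2) q]]] w(4)])
  then show "\<exists>w t r. (w, t) \<in> elts y \<and> (r, q) \<in> R \<and> (r, t) \<in> R \<and> forces_eq R x' w r"
    using w(1-3) by blast
qed

lemma forces_mem_cong_right:
  assumes "forces_mem R x y p" "forces_eq R y y' p"
  shows "forces_mem R x y' p"
  unfolding forces_mem_iff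
proof (intro allI impI)
  fix q assume q: "(q, p) \<in> R"
  obtain w t r where w: "(w, t) \<in> elts y" "(r, q) \<in> R" "(r, t) \<in> R" "forces_eq R x w r"
    by (rule forces_memE[OF assms(1) q])
  obtain v s r' where v: "(v, s) \<in> elts y'" "(r', r) \<in> R" "(r', s) \<in> R" "forces_eq R w v r'"
    by (rule forces_eq_elts[OF assms(2) w(1) trans[OF w(2) q] w(3)])
  have "forces_eq R x v r'"
    by (rule forces_eq_trans[OF forces_eq_mono[OF w(4) v(2)] v(4)])
  then show "\<exists>v t r. (v, t) \<in> elts y' \<and> (r, q) \<in> R \<and> (r, t) \<in> R \<and> forces_eq R x v r"
    using v(1,3) trans[OF v(2) w(2)] by blast
qed

lemma forces_mono: "forces R p \<phi> \<Longrightarrow> (q, p) \<in> R \<Longrightarrow> forces R q \<phi>"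
  by (induction \<phi> arbitrary: p q) (auto intro: forces_eq_mono forces_mem_mono trans)

text \<open>The atomic cases hold because atomic forcing is defined by density, and all other
  clauses of the language are universal. This is what removes the double negation hidden in
  \<open>Imp\<close>.\<close>

lemma forces_regular:
  "(\<And>q. (q, p) \<in> R \<Longrightarrow> \<exists>r. (r, q) \<in> R \<and> forces R r \<phi>) \<Longrightarrow> forces R p \<phi>"
proof (induction \<phi> arbitrary: p)
  case (Eq x y)
  then show ?case by (simp add: forces_eq_regular)
next
  case (Mem x y)
  then show ?case by (simp add: forces_mem_regular)
next
  case (Neg \<phi>)
  have False if q: "(q, p) \<in> R" "forces R q \<phi>" for q
  proof -
    obtain r where "(r, q) \<in> R" "\<forall>t. (t, r) \<in> R \<longrightarrow> \<not> forces R t \<phi>"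
      using Neg.prems[OF q(1)] by auto
    then show False using refl_left forces_mono[OF q(2)] by blast
  qed
  then show ?case by auto
next
  case (Conj \<phi> \<psi>)
  have "forces R p \<phi>" by (rule Conj.IH) (use Conj.prems in auto)
  moreover have "forces R p \<psi>" by (rule Conj.IH) (use Conj.prems in auto)
  ultimately show ?case by simp
next
  case (Forall \<phi>)
  have "forces R p (\<phi> x)" if "is_name R x" for x
    by (rule Forall.IH) (use Forall.prems that in auto)
  then show ?case by simp
next
  case (ForallN A \<phi>)
  have "forces R p (\<phi> x)" if "x \<in> A" for x
    by (rule ForallN.IH) (use ForallN.prems that in auto)
  then show ?case by simp
qed

text \<open>With \<open>Imp\<close> coded by \<open>Neg\<close> and \<open>Conj\<close>, unfolding
  only shows that \<psi> is forced densely below \<open>q\<close>; \<open>forces_regular\<close>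
  upgrades this to \<open>q\<close> itself.\<close>

lemma forces_Imp:
  "forces R p (Imp \<phi> \<psi>) \<longleftrightarrow> (\<forall>q. (q, p) \<in> R \<longrightarrow> forces R q \<phi> \<longrightarrow> forces R q \<psi>)"
proof (intro iffI allI impI)
  fix q assume p: "forces R p (Imp \<phi> \<psi>)" and q: "(q, p) \<in> R" "forces R q \<phi>"
  show "forces R q \<psi>"
  proof (rule forces_regular)
    fix r assume r: "(r, q) \<in> R"
    show "\<exists>t. (t, r) \<in> R \<and> forces R t \<psi>"
      using p trans[OF r q(1)] forces_mono[OF q(2) r] by (auto simp: Imp_def)
  qed
next
  assume "\<forall>q. (q, p) \<in> R \<longrightarrow> forces R q \<phi> \<longrightarrow> forces R q \<psi>"
  then show "forces R p (Imp \<phi> \<psi>)"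
    using refl_left by (fastforce simp: Imp_def)
qed

lemma forces_Exists:
  "forces R p (Exists \<phi>) \<longleftrightarrow>
     (\<forall>q. (q, p) \<in> R \<longrightarrow> (\<exists>r x. (r, q) \<in> R \<and> is_name R x \<and> forces R r (\<phi> x)))"
  by (simp add: Exists_def) blast

lemma forces_Forall_in:
  "forces R p (Forall_in x \<phi>) \<longleftrightarrow>
     (\<forall>y q. is_name R y \<longrightarrow> (q, p) \<in> R \<longrightarrow> forces_mem R y x q \<longrightarrow> forces R q (\<phi> y))"
  by (auto simp: Forall_in_def forces_Imp)

lemma forces_Forall_inD:
  assumes "forces R p (Forall_in x \<phi>)" "is_name R y" "(q, p) \<in> R" "forces_mem R y x q"
  shows "forces R q (\<phi> y)"
  using assms unfolding forces_Forall_in by blast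

lemma forces_Exists_in:
  "forces R p (Exists_in x \<phi>) \<longleftrightarrow>
     (\<forall>q. (q, p) \<in> R \<longrightarrow>
       (\<exists>r y. (r, q) \<in> R \<and> is_name R y \<and> forces_mem R y x r \<and> forces R r (\<phi> y)))"
  by (auto simp: Exists_in_def forces_Exists)

lemma forces_Exists_inI:
  assumes "\<And>q. (q, p) \<in> R \<Longrightarrow>
      \<exists>r y. (r, q) \<in> R \<and> is_name R y \<and> forces_mem R y x r \<and> forces R r (\<phi> y)"
  shows "forces R p (Exists_in x \<phi>)"
  using assms by (simp add: forces_Exists_in)


section \<open>Canonical names\<close>

lemma elts_seq_name: "elts (seq_name R X) = {(x, p). \<exists>k. X k = Some x \<and> p \<in> Field R}"
proof -
  have "(x, p) \<in> elts (seq_name R X) \<longleftrightarrow> (\<exists>k. X k = Some x \<and> p \<in> Field R)"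
    for x p
  proof
    assume "(x, p) \<in> elts (seq_name R X)"
    then obtain i A where "entries (seq_name R X) i = Some (x, A)" "p \<in> A"
      by (auto simp: elts_def)
    then show "\<exists>k. X k = Some x \<and> p \<in> Field R"
      by (cases i) (auto simp: seq_name_def)
  next
    assume "\<exists>k. X k = Some x \<and> p \<in> Field R"
    then obtain k where "X k = Some x" "p \<in> Field R" by blast
    then have "entries (seq_name R X) (Inl k) = Some (x, Field R)" "p \<in> Field R"
      by (auto simp: seq_name_def)
    then show "(x, p) \<in> elts (seq_name R X)"
      unfolding elts_def by blast
  qed
  then show ?thesis by auto
qed

lemma is_name_seq_name: "(\<And>k x. X k = Some x \<Longrightarrow> is_name R x) \<Longrightarrow> is_name R (seq_name R X)"
  by (rule is_name.intros) (auto simp: seq_name_def split: sum.splits)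

lemma chk_eq_chk_set: "chk R n = chk_set R {..<n}"
  by (subst chk.simps) (simp add: chk_set_def)

lemma is_name_chk: "is_name R (chk R n)"
proof (induction n rule: less_induct)
  case (less n)
  show ?case
    by (subst chk.simps, rule is_name_seq_name) (auto simp: less split: if_splits)
qed

lemma elts_chk_set: "elts (chk_set R A) = {(x, p). \<exists>k\<in>A. x = chk R k \<and> p \<in> Field R}"
  unfolding chk_set_def elts_seq_name by auto

text \<open>Each entry of a check name carries the whole of \<open>Field R\<close>, so the condition
  attached to a witness can be taken to be \<open>r\<close> itself and drops out.\<close>

lemma forces_mem_chk_set:
  "forces_mem R x (chk_set R A) p \<longleftrightarrow>
     (\<forall>q. (q, p) \<in> R \<longrightarrow> (\<exists>r n. (r, q) \<in> R \<and> n \<in> A \<and> forces_eq R x (chk R n) r))"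
proof -
  have "(\<exists>w t r. (w, t) \<in> elts (chk_set R A) \<and> (r, q) \<in> R \<and> (r, t) \<in> R \<and> forces_eq R x w r) \<longleftrightarrow>
      (\<exists>r n. (r, q) \<in> R \<and> n \<in> A \<and> forces_eq R x (chk R n) r)" for q
    using refl_left FieldI1 by (fastforce simp: elts_chk_set)
  then show ?thesis
    unfolding forces_mem_iff by blast
qed

lemma forces_mem_chk_setI: "n \<in> A \<Longrightarrow> forces_mem R (chk R n) (chk_set R A) p"
  unfolding forces_mem_chk_set using forces_eq_refl refl_left by blast

lemma forces_mem_chkI: "k < n \<Longrightarrow> forces_mem R (chk R k) (chk R n) p"
  unfolding chk_eq_chk_set[of n] by (rule forces_mem_chk_setI) simp

lemma forces_mem_chkE:
  assumes "forces_mem R x (chk R n) p" "(q, p) \<in> R"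
  obtains r k where "(r, q) \<in> R" "k < n" "forces_eq R x (chk R k) r"
  using assms unfolding chk_eq_chk_set[of n] forces_mem_chk_set by auto

text \<open>If \<open>n < m\<close>, then \<open>n \<in> m = n\<close> is forced, so
  \<open>n\<close> is forced equal to some \<open>k < n\<close>, against the induction hypothesis;
  the other case is the mirror image. A condition outside \<open>Field R\<close> has nothing below
  it and forces all equalities, whence the second assumption.\<close>

lemma forces_eq_chk:
  assumes "forces_eq R (chk R n :: ('p, 'i) name) (chk R m) p" "p \<in> Field R"
  shows "n = m"
  using assms
proof (induction m arbitrary: n p rule: less_induct)
  case (less m)
  let ?c = "chk R :: nat \<Rightarrow> ('p, 'i) name"
  have pp: "(p, p) \<in> R" using refl[OF less.prems(2)] .
  show ?case
  proof (cases n m rule: linorder_cases)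
    case less': less
    have "forces_mem R (?c n) (?c n) p"
      by (rule forces_mem_cong_right[OF forces_mem_chkI[OF less'] forces_eq_sym[OF less.prems(1)]])
    then obtain r k where r: "(r, p) \<in> R" "k < n" "forces_eq R (?c n) (?c k) r"
      using forces_mem_chkE pp by blast
    have "k = n"
      by (rule less.IH[OF less' forces_eq_sym[OF r(3)] FieldI1[OF r(1)]])
    then show ?thesis using r(2) by simp
  next
    case greater
    have "forces_mem R (?c m) (?c m) p"
      by (rule forces_mem_cong_right[OF forces_mem_chkI[OF greater] less.prems(1)])
    then obtain r k where r: "(r, p) \<in> R" "k < m" "forces_eq R (?c m) (?c k) r"
      using forces_mem_chkE pp by blast
    have "m = k"
      by (rule less.IH[OF r(2,3) FieldI1[OF r(1)]])
    then show ?thesis using r(2) by simp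
  qed
qed

lemma forces_eq_chk_unique:
  assumes "forces_eq R x (chk R n) p" "forces_eq R x (chk R m) p" "p \<in> Field R"
  shows "n = m"
  by (rule forces_eq_chk[OF forces_eq_trans[OF forces_eq_sym[OF assms(1)] assms(2)] assms(3)])

section \<open>Unordered and ordered pairs\<close>

lemma is_name_upair: "is_name R x \<Longrightarrow> is_name R y \<Longrightarrow> is_name R (upair R x y)"
  unfolding upair_def by (rule is_name_seq_name) (auto split: if_splits)

lemma is_name_opair: "is_name R x \<Longrightarrow> is_name R y \<Longrightarrow> is_name R (opair R x y)"
  unfolding opair_def by (simp add: is_name_upair)

lemma elts_upair: "elts (upair R x y) = {(z, p). (z = x \<or> z = y) \<and> p \<in> Field R}"
proof -
  have "(\<exists>k::nat. (if k = 0 then Some x else if k = 1 then Some y else None) = Some z) \<longleftrightarrow> z = x \<or> z = y"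
    for z
  proof
    assume "z = x \<or> z = y"
    then show "\<exists>k::nat. (if k = 0 then Some x else if k = 1 then Some y else None) = Some z"
      by (metis zero_neq_one)
  qed (auto split: if_splits)
  then show ?thesis unfolding upair_def elts_seq_name by auto
qed

lemma forces_eq_upairI:
  assumes "forces_eq R x x' p" "forces_eq R y y' p"
  shows "forces_eq R (upair R x y) (upair R x' y') p"
  by (rule forces_eqI; simp add: elts_upair; metis assms forces_eq_mono refl_left FieldI1)

lemma forces_eq_opairI:
  assumes "forces_eq R x x' p" "forces_eq R y y' p"
  shows "forces_eq R (opair R x y) (opair R x' y') p"
  unfolding opair_def by (intro forces_eq_upairI assms)

lemma forces_eq_upairD:
  assumes "forces_eq R (upair R x y) (upair R x' y') p" "(q, p) \<in> R" "z = x \<or> z = y"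
  shows "\<exists>r. (r, q) \<in> R \<and> (forces_eq R z x' r \<or> forces_eq R z y' r)"
proof -
  have z: "(z, q) \<in> elts (upair R x y)"
    using assms(2,3) FieldI1 by (fastforce simp: elts_upair)
  obtain w t r where "(w, t) \<in> elts (upair R x' y')" "(r, q) \<in> R" "(r, t) \<in> R" "forces_eq R z w r"
    by (rule forces_eq_elts[OF assms(1) z assms(2) refl_left[OF assms(2)]])
  then show ?thesis by (auto simp: elts_upair)
qed

lemma forces_eq_upair_singletonD:
  assumes "forces_eq R (upair R x x) (upair R x' y') p" "z = x' \<or> z = y'"
  shows "forces_eq R x z p"
  by (rule forces_eq_regular)
    (use forces_eq_upairD[OF forces_eq_sym[OF assms(1)] _ assms(2)] forces_eq_sym in blast)

lemma forces_eq_opair_fst: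
  assumes "forces_eq R (opair R x y) (opair R x' y') p"
  shows "forces_eq R x x' p"
proof (rule forces_eq_regular)
  fix q assume "(q, p) \<in> R"
  then show "\<exists>r. (r, q) \<in> R \<and> forces_eq R x x' r"
    using forces_eq_upairD[OF assms[unfolded opair_def] _ disjI1[OF HOL.refl]]
      forces_eq_upair_singletonD by blast
qed

text \<open>The Kuratowski argument, carried out densely: below \<open>q\<close>, the set
  \<open>{x, y}\<close> is one of \<open>{x', x'}\<close> and \<open>{x', y'}\<close>, so
  \<open>y\<close> is \<open>x'\<close> or \<open>y'\<close>. Only the first alternative needs
  work.\<close>

lemma forces_eq_opair_snd:
  assumes "forces_eq R (opair R x y) (opair R x' y') p"
  shows "forces_eq R y y' p"
proof (rule forces_eq_regular)
  fix q assume q: "(q, p) \<in> R"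
  have x: "forces_eq R x x' q"
    using forces_eq_opair_fst[OF assms] q forces_eq_mono by blast
  obtain r where r: "(r, q) \<in> R"
    "forces_eq R (upair R x y) (upair R x' x') r \<or> forces_eq R (upair R x y) (upair R x' y') r"
    using forces_eq_upairD[OF assms[unfolded opair_def] q disjI2[OF HOL.refl]] by blast
  obtain r' where r': "(r', r) \<in> R" "forces_eq R y x' r' \<or> forces_eq R y y' r'"
    using r(2) forces_eq_upairD[OF _ refl_left[OF r(1)] disjI2[OF HOL.refl]] by metis
  show "\<exists>r. (r, q) \<in> R \<and> forces_eq R y y' r"
  proof (cases "forces_eq R y y' r'")
    case True
    then show ?thesis using r' r trans by blast
  next
    case False
    \<comment> \<open>Now \<open>y = x' = x\<close>, so both members of the left-hand pair have only
      \<open>x\<close> as an element. Matching \<open>{x', y'}\<close> with one of them gives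
      \<open>y' = x\<close> or \<open>y' = y\<close>, which is \<open>y = y'\<close> either
      way.\<close>
    then have yx: "forces_eq R y x' r'" using r' by blast
    have r'p: "(r', p) \<in> R" "(r', q) \<in> R" using r r' q trans by blast+
    have "\<exists>s. (s, r') \<in> R \<and> (forces_eq R (upair R x' y') (upair R x x) s \<or>
        forces_eq R (upair R x' y') (upair R x y) s)"
      using forces_eq_upairD[OF forces_eq_sym[OF assms, unfolded opair_def] r'p(1)
        disjI2[OF HOL.refl]] .
    then obtain s where s: "(s, r') \<in> R" "forces_eq R (upair R x' y') (upair R x x) s \<or>
        forces_eq R (upair R x' y') (upair R x y) s" by blast
    obtain s' where s': "(s', s) \<in> R" "forces_eq R y' x s' \<or> forces_eq R y' y s'"
      using s(2) forces_eq_upairD[OF _ refl_left[OF s(1)] disjI2[OF HOL.refl]] by metis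
    have "(s', q) \<in> R" "(s', r') \<in> R" using s' s r'p trans by blast+
    moreover from this have "forces_eq R y y' s'"
      using s'(2) x yx forces_eq_mono forces_eq_trans forces_eq_sym by metis
    ultimately show ?thesis by blast
  qed
qed

section \<open>Names for functions, given by sets of deciding conditions\<close>

definition fn_name :: "(nat \<Rightarrow> nat \<Rightarrow> 'p set) \<Rightarrow> ('p, 'i) name" where
  "fn_name D = Name (\<lambda>i. case i of
       Inl k \<Rightarrow> (let (n, m) = prod_decode k in Some (opair R (chk R n) (chk R m), D n m))
     | Inr _ \<Rightarrow> None)"

lemma elts_fn_name:
  "elts (fn_name D) = {(x, p). \<exists>n m. x = opair R (chk R n) (chk R m) \<and> p \<in> D n m}"
proof -
  have "(x, p) \<in> elts (fn_name D) \<longleftrightarrow> (\<exists>n m. x = opair R (chk R n) (chk R m) \<and> p \<in> D n m)"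
    for x p
  proof
    assume "\<exists>n m. x = opair R (chk R n) (chk R m) \<and> p \<in> D n m"
    then obtain n m where "x = opair R (chk R n) (chk R m)" "p \<in> D n m" by blast
    then have "entries (fn_name D) (Inl (prod_encode (n, m))) = Some (x, D n m)" "p \<in> D n m"
      by (auto simp: fn_name_def)
    then show "(x, p) \<in> elts (fn_name D)"
      unfolding elts_def by blast
  next
    assume "(x, p) \<in> elts (fn_name D)"
    then obtain i A where "entries (fn_name D) i = Some (x, A)" "p \<in> A"
      by (auto simp: elts_def)
    then show "\<exists>n m. x = opair R (chk R n) (chk R m) \<and> p \<in> D n m"
      by (cases i) (auto simp: fn_name_def split: prod.splits)
  qed
  then show ?thesis by auto
qed

lemma is_name_fn_name: "(\<And>n m. D n m \<subseteq> Field R) \<Longrightarrow> is_name R (fn_name D)"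
  by (rule is_name.intros)
    (auto simp: fn_name_def is_name_chk intro!: is_name_opair split: sum.splits prod.splits)

lemma forces_mem_fn_name:
  assumes "forces_mem R (opair R x y) (fn_name D) p" "(q, p) \<in> R"
  obtains r s n m where "(r, q) \<in> R" "(r, s) \<in> R" "s \<in> D n m"
    "forces_eq R x (chk R n) r" "forces_eq R y (chk R m) r"
proof -
  obtain w s r where "(w, s) \<in> elts (fn_name D)" "(r, q) \<in> R" "(r, s) \<in> R"
    "forces_eq R (opair R x y) w r"
    using assms unfolding forces_mem_iff by blast
  moreover from this(1) obtain n m where "w = opair R (chk R n) (chk R m)" "s \<in> D n m"
    by (auto simp: elts_fn_name)
  ultimately show thesis
    using that forces_eq_opair_fst forces_eq_opair_snd by blast
qed

lemma forces_mem_fn_nameI: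
  assumes "(p, s) \<in> R" "s \<in> D n m"
  shows "forces_mem R (opair R (chk R n) (chk R m)) (fn_name D) p"
  using assms by (intro forces_mem_elts[of _ s]) (auto simp: elts_fn_name)

text \<open>\<open>D n m\<close> plays the set of conditions that decide the value at
  \<open>n\<close> to be \<open>m\<close>. Density gives totality; a common extension of conditions
  from \<open>D n m\<close> and \<open>D n m'\<close> lies in both by openness, so disjointness
  gives uniqueness. The general \<open>B\<close> covers both \<omega> and \<open>2\<close>.\<close>

lemma forces_fun_fn_name:
  assumes open': "\<And>n m q r. q \<in> D n m \<Longrightarrow> (r, q) \<in> R \<Longrightarrow> r \<in> D n m"
    and ran: "\<And>n m. D n m \<noteq> {} \<Longrightarrow> m \<in> B"
    and disj: "\<And>n m m' q. q \<in> D n m \<Longrightarrow> q \<in> D n m' \<Longrightarrow> m = m'"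
    and dense: "\<And>n q. (q, p) \<in> R \<Longrightarrow> \<exists>r m. (r, q) \<in> R \<and> r \<in> D n m"
  shows "forces R p (fun_fm R (fn_name D :: ('p, 'i) name) (omega R) (chk_set R B))"
  unfolding fun_fm_def forces.simps(4)
proof (intro conjI)
  let ?f = "fn_name D :: ('p, 'i) name"
  show "forces R p (Forall_in ?f (\<lambda>z. Exists_in (omega R) (\<lambda>x.
      Exists_in (chk_set R B) (\<lambda>y. Eq z (opair R x y)))))"
    unfolding forces_Forall_in
  proof (intro allI impI, rule forces_Exists_inI)
    fix z q q' assume "forces_mem R z ?f q" "(q', q) \<in> R"
    then obtain w s r where r: "(w, s) \<in> elts ?f" "(r, q') \<in> R" "forces_eq R z w r"
      unfolding forces_mem_iff by blast
    from r(1) obtain n m where nm: "w = opair R (chk R n) (chk R m)" "s \<in> D n m"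
      by (auto simp: elts_fn_name)
    have "forces R r (Exists_in (chk_set R B) (\<lambda>y. Eq z (opair R (chk R n) y)))"
    proof (rule forces_Exists_inI)
      fix u assume "(u, r) \<in> R"
      then have "(u, u) \<in> R" "forces R u (Eq z (opair R (chk R n) (chk R m)))"
        using refl_left forces_eq_mono r(3) nm(1) by auto
      moreover have "m \<in> B" using ran nm(2) by blast
      ultimately show "\<exists>v y. (v, u) \<in> R \<and> is_name R y \<and> forces_mem R y (chk_set R B) v \<and>
          forces R v (Eq z (opair R (chk R n) y))"
        using forces_mem_chk_setI is_name_chk by blast
    qed
    then show "\<exists>r x. (r, q') \<in> R \<and> is_name R x \<and> forces_mem R x (omega R) r \<and>
        forces R r (Exists_in (chk_set R B) (\<lambda>y. Eq z (opair R x y)))"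
      using r(2) is_name_chk forces_mem_chk_setI by blast
  qed
  show "forces R p (Forall_in (omega R) (\<lambda>x. Exists_in (chk_set R B) (\<lambda>y.
      Mem (opair R x y) ?f)))"
    unfolding forces_Forall_in
  proof (intro allI impI, rule forces_Exists_inI)
    fix x :: "('p, 'i) name" and q q'
    assume "(q, p) \<in> R" "forces_mem R x (omega R) q" "(q', q) \<in> R"
    then obtain r n where r: "(r, q') \<in> R" "forces_eq R x (chk R n) r" "(r, p) \<in> R"
      unfolding forces_mem_chk_set using trans by metis
    then obtain r' m where r': "(r', r) \<in> R" "r' \<in> D n m"
      using dense by blast
    then have "forces_mem R (opair R (chk R n) (chk R m)) ?f r'"
      using forces_mem_fn_nameI refl_left by blast
    moreover have "forces_eq R (opair R (chk R n) (chk R m)) (opair R x (chk R m)) r'"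
      using r r' forces_eq_mono forces_eq_sym forces_eq_refl by (intro forces_eq_opairI) blast+
    ultimately have "forces R r' (Mem (opair R x (chk R m)) ?f)"
      using forces_mem_cong_left by simp
    moreover have "(r', q') \<in> R" "m \<in> B" using r r' trans ran by blast+
    ultimately show "\<exists>r y. (r, q') \<in> R \<and> is_name R y \<and> forces_mem R y (chk_set R B) r \<and>
        forces R r (Mem (opair R x y) ?f)"
      using is_name_chk forces_mem_chk_setI by blast
  qed
  have unique: "forces_eq R y y' q" if y: "forces_mem R (opair R x y) ?f q"
      "forces_mem R (opair R x y') ?f q" for x y y' q
  proof (rule forces_eq_regular)
    fix q' assume q': "(q', q) \<in> R"
    obtain r s n m where r: "(r, q') \<in> R" "(r, s) \<in> R" "s \<in> D n m"
        "forces_eq R x (chk R n) r" "forces_eq R y (chk R m) r"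
      by (rule forces_mem_fn_name[OF y(1) q'])
    obtain r' s' n' m' where r': "(r', r) \<in> R" "(r', s') \<in> R" "s' \<in> D n' m'"
        "forces_eq R x (chk R n') r'" "forces_eq R y' (chk R m') r'"
      by (rule forces_mem_fn_name[OF y(2) trans[OF r(1) q']])
    have "n = n'"
      by (rule forces_eq_chk_unique[OF forces_eq_mono[OF r(4) r'(1)] r'(4) FieldI1[OF r'(1)]])
    moreover have "r' \<in> D n m" "r' \<in> D n' m'"
      using open'[OF r(3) trans[OF r'(1) r(2)]] open'[OF r'(3,2)] .
    ultimately have "m = m'" using disj by blast
    then have "forces_eq R y y' r'"
      using forces_eq_trans[OF forces_eq_mono[OF r(5) r'(1)]] forces_eq_sym[OF r'(5)] by blast
    then show "\<exists>r. (r, q') \<in> R \<and> forces_eq R y y' r"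
      using trans[OF r'(1) r(1)] by blast
  qed
  show "forces R p (Forall_in (omega R) (\<lambda>x. Forall_in (chk_set R B) (\<lambda>y.
      Forall_in (chk_set R B) (\<lambda>y'.
        Imp (Conj (Mem (opair R x y) ?f) (Mem (opair R x y') ?f)) (Eq y y')))))"
    unfolding forces_Forall_in forces_Imp forces.simps(1,2,4) using unique by blast
qed

lemma forces_fun_value:
  assumes f: "forces R p (fun_fm R f (omega R) (chk_set R B))" and q: "(q, p) \<in> R"
  obtains r m where "(r, q) \<in> R" "m \<in> B" "forces_mem R (opair R (chk R n) (chk R m)) f r"
proof -
  have "forces R p (Forall_in (omega R) (\<lambda>x. Exists_in (chk_set R B) (\<lambda>y. Mem (opair R x y) f)))"
    using f unfolding fun_fm_def by simp
  then have "forces R q (Exists_in (chk_set R B) (\<lambda>y. Mem (opair R (chk R n) y) f))"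
    by (rule forces_Forall_inD[OF _ is_name_chk q forces_mem_chk_setI]) simp
  then obtain r y where r: "(r, q) \<in> R" "forces_mem R y (chk_set R B) r"
      "forces_mem R (opair R (chk R n) y) f r"
    using refl_left[OF q] unfolding forces_Exists_in by auto
  then obtain r' m where r': "(r', r) \<in> R" "m \<in> B" "forces_eq R y (chk R m) r'"
    using refl_left unfolding forces_mem_chk_set by blast
  have "forces_mem R (opair R (chk R n) (chk R m)) f r'"
    using forces_mem_cong_left[OF forces_mem_mono[OF r(3) r'(1)]] r' forces_eq_opairI forces_eq_refl
    by blast
  then show thesis using that r r' trans by blast
qed

lemma forces_fun_unique:
  fixes f :: "('p, 'i) name"
  assumes f: "forces R p (fun_fm R f (omega R) (chk_set R B))"
    and q: "(q, p) \<in> R" and B: "m \<in> B" "m' \<in> B"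
    and m: "forces_mem R (opair R (chk R n) (chk R m)) f q"
      "forces_mem R (opair R (chk R n) (chk R m')) f q"
  shows "m = m'"
proof -
  note qq = refl_left[OF q]
  have "forces R p (Forall_in (omega R) (\<lambda>x. Forall_in (chk_set R B) (\<lambda>y.
      Forall_in (chk_set R B) (\<lambda>y'. Imp (Conj (Mem (opair R x y) f) (Mem (opair R x y') f)) (Eq y y')))))"
    using f unfolding fun_fm_def by simp
  from forces_Forall_inD[OF this is_name_chk q forces_mem_chk_setI[OF UNIV_I]]
  have "forces R q (Forall_in (chk_set R B) (\<lambda>y. Forall_in (chk_set R B) (\<lambda>y'.
      Imp (Conj (Mem (opair R (chk R n) y) f) (Mem (opair R (chk R n) y') f)) (Eq y y'))))" .
  from forces_Forall_inD[OF forces_Forall_inD[OF this is_name_chk qq forces_mem_chk_setI[OF B(1)]]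
      is_name_chk qq forces_mem_chk_setI[OF B(2)]]
  have "forces R q (Eq (chk R m) (chk R m') :: ('p, 'i) fm)"
    unfolding forces_Imp using qq m by simp
  then have "forces_eq R (chk R m :: ('p, 'i) name) (chk R m') q" by simp
  then show ?thesis by (rule forces_eq_chk[OF _ FieldI1[OF q]])
qed


section \<open>Finite approximations of reals\<close>

abbreviation bit_in :: "'p \<Rightarrow> ('p, 'i) name \<Rightarrow> nat \<Rightarrow> bool \<Rightarrow> bool" where
  "bit_in p z k b \<equiv> forces_mem R (opair R (chk R k) (chk R (of_bool b))) z p"

text \<open>The list stands for the function from \<open>[k, k + length s)\<close> to
  \<open>2\<close> whose value at \<open>k + j\<close> is \<open>s ! j\<close>; its start
  \<open>k\<close> is a separate argument because a list does not record it.\<close>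

definition forces_block :: "'p \<Rightarrow> ('p, 'i) name \<Rightarrow> nat \<Rightarrow> bool list \<Rightarrow> bool" where
  "forces_block p z k s \<longleftrightarrow> (\<forall>j<length s. bit_in p z (k + j) (s ! j))"

lemma forces_blockD: "forces_block p z k s \<Longrightarrow> j < length s \<Longrightarrow> bit_in p z (k + j) (s ! j)"
  unfolding forces_block_def by blast

lemma forces_block_singleton: "forces_block p z k [b] \<longleftrightarrow> bit_in p z k b"
  unfolding forces_block_def by simp

lemma forces_block_append:
  "forces_block p z k (s @ t) \<longleftrightarrow> forces_block p z k s \<and> forces_block p z (k + length s) t"
proof -
  have "(\<forall>j<length (s @ t). P j) \<longleftrightarrow> (\<forall>j<length s. P j) \<and> (\<forall>j<length t. P (length s + j))" for P
    by (auto simp: less_diff_conv2 not_less) (metis add_diff_inverse_nat nat_add_left_cancel_less)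
  then show ?thesis
    unfolding forces_block_def by (auto simp: nth_append add.assoc)
qed

lemma forces_block_mono: "forces_block p z k s \<Longrightarrow> (q, p) \<in> R \<Longrightarrow> forces_block q z k s"
  unfolding forces_block_def using forces_mem_mono by blast

lemma real_fm_alt: "real_fm R x = fun_fm R x (omega R) (chk_set R {..<2})"
  by (simp add: real_fm_def chk_eq_chk_set)

lemma less_2_bool: "(m::nat) < 2 \<longleftrightarrow> (\<exists>b. m = of_bool b)"
  by (metis of_bool_eq(1) of_bool_eq(2) less_2_cases of_bool_less_eq_one one_add_one
      le_imp_less_Suc Suc_1 One_nat_def)

lemma forces_real_decide:
  assumes "forces R p (real_fm R y)" "(q, p) \<in> R"
  obtains r u where "(r, q) \<in> R" "length u = n" "forces_block r y 0 u"
proof -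
  have "\<exists>r u. (r, q) \<in> R \<and> length u = n \<and> forces_block r y 0 u"
  proof (induction n)
    case 0
    then show ?case using refl_left[OF assms(2)] by (auto simp: forces_block_def)
  next
    case (Suc n)
    then obtain r u where r: "(r, q) \<in> R" "length u = n" "forces_block r y 0 u" by blast
    have "(r, p) \<in> R" using r assms trans by blast
    then obtain r' m where r': "(r', r) \<in> R" "m \<in> {..<2}"
        "forces_mem R (opair R (chk R n) (chk R m)) y r'"
      using forces_fun_value[OF assms(1)[unfolded real_fm_alt]] by metis
    then obtain b where "m = of_bool b" using less_2_bool by auto
    then have "forces_block r' y 0 (u @ [b])"
      using r(2) r'(3) forces_block_mono[OF r(3) r'(1)]
      unfolding forces_block_append forces_block_singleton by simp
    then show ?case using r r' trans by (metis length_append_singleton)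
  qed
  then show thesis using that by blast
qed

text \<open>The bit variable of \<open>agree_fm\<close> ranges over all names for elements of
  \<open>2\<close>, so it is first decided to be a numeral; uniqueness of the value then identifies
  it with the bit in \<open>u\<close>.\<close>

lemma forces_agreeI:
  assumes x: "forces R p (real_fm R x)" and y: "forces R p (real_fm R y)"
    and u: "length u = n" "forces_block p x 0 u" "forces_block p y 0 u"
  shows "forces R p (agree_fm R n x y)"
proof -
  have transfer: "forces_mem R (opair R (chk R k) b) y' q"
    if x': "forces R p (real_fm R x')" "forces_block p x' 0 u" "forces_block p y' 0 u"
      and k: "k < n" and q: "(q, p) \<in> R" "forces_mem R b (chk R 2) q"
        "forces_mem R (opair R (chk R k) b) x' q" for x' y' k b q
  proof (rule forces_mem_regular)
    fix q' assume q': "(q', q) \<in> R"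
    obtain r m where r: "(r, q') \<in> R" "m < 2" "forces_eq R b (chk R m) r"
      by (rule forces_mem_chkE[OF q(2) q'])
    then have rq: "(r, q) \<in> R" "(r, p) \<in> R" using q' q trans by blast+
    have bm: "forces_eq R (opair R (chk R k) b) (opair R (chk R k) (chk R m)) r"
      using r forces_eq_opairI forces_eq_refl by blast
    have ku: "k < length u" using k u(1) by simp
    have bits: "bit_in r x' k (u ! k)" "bit_in r y' k (u ! k)"
      using forces_blockD[OF forces_block_mono[OF x'(2) rq(2)] ku]
        forces_blockD[OF forces_block_mono[OF x'(3) rq(2)] ku] unfolding add_0_left .
    have "forces_mem R (opair R (chk R k) (chk R m)) x' r"
      using forces_mem_cong_left[OF forces_mem_mono[OF q(3) rq(1)] bm] .
    then have "m = of_bool (u ! k)"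
      using forces_fun_unique[OF x'(1)[unfolded real_fm_alt] rq(2) _ _ _ bits(1)] r(2) by simp
    then have "forces_mem R (opair R (chk R k) b) y' r"
      using bits(2) bm forces_mem_cong_left forces_eq_sym by blast
    then show "\<exists>r. (r, q') \<in> R \<and> forces_mem R (opair R (chk R k) b) y' r"
      using r by blast
  qed
  show ?thesis
    unfolding agree_fm_def forces.simps(6) forces_Forall_in Iff_def forces.simps(4) forces_Imp
      forces.simps(2)
    using transfer[OF x u(2,3)] transfer[OF y u(3,2)] trans forces_mem_mono
    by (metis lessThan_iff)
qed

lemma forces_agreeD:
  assumes "forces R p (agree_fm R n x y)" "p \<in> Field R" "k < n" "bit_in p x k b"
  shows "bit_in p y k b"
proof -
  have "forces_mem R (chk R (of_bool b)) (chk R 2) p"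
    by (rule forces_mem_chkI) simp
  then show ?thesis
    using assms refl[OF assms(2)] is_name_chk
    unfolding agree_fm_def forces.simps(6) forces_Forall_in Iff_def forces.simps(4) forces_Imp
    by (metis lessThan_iff forces.simps(2))
qed

lemma forces_block_agree:
  assumes "forces R p (agree_fm R n x y)" "p \<in> Field R" "forces_block p x 0 u" "length u = n"
  shows "forces_block p y 0 u"
  unfolding forces_block_def
proof (intro allI impI)
  fix j assume j: "j < length u"
  show "bit_in p y (0 + j) (u ! j)"
    by (rule forces_agreeD[OF assms(1,2)]) (use forces_blockD[OF assms(3) j] j assms(4) in simp_all)
qed

lemma forces_block_unique:
  assumes x: "forces R p (real_fm R x)" "p \<in> Field R"
    and "forces_block p x k s" "forces_block p x k t" "length s = length t"
  shows "s = t"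
proof (rule nth_equalityI)
  fix i assume i: "i < length s"
  have "(of_bool (s ! i) :: nat) = of_bool (t ! i)"
    by (rule forces_fun_unique[OF x(1)[unfolded real_fm_alt] refl[OF x(2)] _ _
          forces_blockD[OF assms(3) i] forces_blockD[OF assms(4)]])
      (use i assms(5) in auto)
  then show "s ! i = t ! i" by (simp add: of_bool_eq_iff)
qed (use assms in simp)

text \<open>Padding \<open>u\<close> with zeros gives a ground model real. It serves as the centre
  of the basic neighbourhood of \<open>u\<close> to which nowhere density is applied.\<close>

lemma real_name_exists:
  obtains x :: "('p, 'i) name" where "is_name R x" "\<And>p. forces R p (real_fm R x)"
    "\<And>p. p \<in> Field R \<Longrightarrow> forces_block p x 0 u"
proof
  define c where "c n = (n < length u \<and> u ! n)" for n
  define D where "D n m = (if m = of_bool (c n) then Field R else {})" for n m :: nat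
  let ?x = "fn_name D :: ('p, 'i) name"
  show "is_name R ?x" by (rule is_name_fn_name) (simp add: D_def)
  show "forces R p (real_fm R ?x)" for p
    unfolding real_fm_alt
    by (rule forces_fun_fn_name) (auto simp: D_def intro: FieldI1 refl_left split: if_splits)
  show "forces_block p ?x 0 u" if p: "p \<in> Field R" for p
    unfolding forces_block_def
    by (auto intro!: forces_mem_fn_nameI[OF refl[OF p]] simp: p D_def c_def)
qed


section \<open>Blocks avoiding a nowhere dense set\<close>

text \<open>With the negation unfolded, this is \<open>p\<close> forcing that no element of
  \<open>Z\<close> extends the block \<open>s\<close> placed at \<open>k\<close>.\<close>

definition avoids :: "('p, 'i) name \<Rightarrow> 'p \<Rightarrow> nat \<Rightarrow> bool list \<Rightarrow> bool" where
  "avoids Z p k s \<longleftrightarrow>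
     (\<forall>q z. (q, p) \<in> R \<longrightarrow> is_name R z \<longrightarrow> forces_mem R z Z q \<longrightarrow> \<not> forces_block q z k s)"

lemma avoids_mono: "avoids Z p k s \<Longrightarrow> (q, p) \<in> R \<Longrightarrow> avoids Z q k s"
  unfolding avoids_def using trans by blast

lemma avoids_regular:
  assumes "\<And>q. (q, p) \<in> R \<Longrightarrow> \<exists>r. (r, q) \<in> R \<and> avoids Z r k s"
  shows "avoids Z p k s"
  using assms unfolding avoids_def by (meson forces_mem_mono forces_block_mono refl_left)

lemma avoids_append: "avoids Z p k s \<Longrightarrow> avoids Z p k (s @ t)"
  unfolding avoids_def forces_block_append by blast

lemma avoids_prepend: "avoids Z p (k + length s) t \<Longrightarrow> avoids Z p k (s @ t)"
  unfolding avoids_def forces_block_append by blast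

lemma nowhere_dense_real:
  assumes "forces R p (nowhere_dense_fm R Z)" "(q, p) \<in> R" "is_name R z" "forces_mem R z Z q"
  shows "forces R q (real_fm R z)"
  using assms unfolding nowhere_dense_fm_def by (simp add: forces_Forall_in)

text \<open>Nowhere density yields a real \<open>y\<close> in the neighbourhood of \<open>u\<close>
  and an \<open>n\<close> such that no element of \<open>Z\<close> agrees with \<open>y\<close>
  below \<open>n\<close>; a sufficiently long initial segment of \<open>y\<close> is then the
  required extension of \<open>u\<close>.\<close>

lemma avoids_extension:
  fixes Z :: "('p, 'i) name"
  assumes nwd: "forces R p (nowhere_dense_fm R Z)" and q: "(q, p) \<in> R"
  obtains r s where "(r, q) \<in> R" "avoids Z r 0 (u @ s)"
proof -
  obtain x :: "('p, 'i) name" where x: "is_name R x" "\<And>p. forces R p (real_fm R x)"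
    "\<And>p. p \<in> Field R \<Longrightarrow> forces_block p x 0 u"
    using real_name_exists by blast
  let ?n = "length u"
  have "forces R p (Imp (real_fm R x) (ForallN UNIV (\<lambda>n. Neg (Forall (\<lambda>y.
             Imp (Conj (real_fm R y) (agree_fm R n x y)) (closure_fm R Z y))))))"
    using nwd x(1) unfolding nowhere_dense_fm_def forces.simps(4,5) by blast
  then have "forces R q (ForallN UNIV (\<lambda>n. Neg (Forall (\<lambda>y.
             Imp (Conj (real_fm R y) (agree_fm R n x y)) (closure_fm R Z y)))))"
    using x(2) q unfolding forces_Imp[of p] by blast
  then have "\<not> forces R q (Forall (\<lambda>y.
             Imp (Conj (real_fm R y) (agree_fm R ?n x y)) (closure_fm R Z y)))"
    using refl_left[OF q] unfolding forces.simps(3,6) by blast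
  then obtain y r where r: "(r, q) \<in> R" "forces R r (real_fm R y)"
      "forces R r (agree_fm R ?n x y)" "\<not> forces R r (closure_fm R Z y)"
    unfolding forces.simps(5) forces_Imp forces.simps(4) by blast
  then obtain n where "\<not> forces R r (Exists_in Z (\<lambda>z. agree_fm R n y z))"
    unfolding closure_fm_def by auto
  then obtain r1 where r1: "(r1, r) \<in> R"
    "\<And>t z. (t, r1) \<in> R \<Longrightarrow> is_name R z \<Longrightarrow> forces_mem R z Z t \<Longrightarrow> \<not> forces R t (agree_fm R n y z)"
    unfolding forces_Exists_in by blast
  \<comment> \<open>The length \<open>?n + n\<close> is enough both to have \<open>u\<close> as an
    initial part and to fix \<open>y\<close> below \<open>n\<close>.\<close>
  obtain r2 v where r2: "(r2, r1) \<in> R" "length v = ?n + n" "forces_block r2 y 0 v"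
    using forces_real_decide[OF r(2) r1(1)] by metis
  have le: "(r2, r) \<in> R" "(r2, q) \<in> R" "r2 \<in> Field R"
    using r r1 r2 trans FieldI1 by metis+
  have "forces_block r2 y 0 u"
    using forces_block_agree[of r2 ?n x y u] forces_mono[OF r(3) le(1)] le x(3) by blast
  moreover have v: "v = take ?n v @ drop ?n v" "length (take ?n v) = length u"
    using r2(2) by auto
  moreover have "forces_block r2 y 0 (take ?n v)"
    using r2(3) forces_block_append v(1) by metis
  ultimately have "take ?n v = u"
    using forces_block_unique[OF forces_mono[OF r(2) le(1)] le(3)] by metis
  then have vu: "v = u @ drop ?n v" using v by simp
  have "avoids Z r2 0 v"
    unfolding avoids_def
  proof (intro allI impI notI)
    fix t z assume t: "(t, r2) \<in> R" "is_name R z" "forces_mem R z Z t" "forces_block t z 0 v"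
    have tr: "(t, r1) \<in> R" "(t, p) \<in> R" "(t, r) \<in> R"
      using t le q r2 trans by blast+
    \<comment> \<open>An element of \<open>Z\<close> through \<open>v\<close> would agree with
      \<open>y\<close> below \<open>n\<close>.\<close>
    have "v = take n v @ drop n v" "length (take n v) = n" using r2(2) by auto
    then have "forces R t (agree_fm R n y z)"
      using forces_agreeI[OF forces_mono[OF r(2) tr(3)] nowhere_dense_real[OF nwd tr(2) t(2,3)]]
        t(4) forces_block_mono[OF r2(3) t(1)] forces_block_append by metis
    then show False using r1(2) t tr by blast
  qed
  then show thesis using that le vu by metis
qed

text \<open>The induction runs over a list \<open>us\<close> of starting segments. Each step
  lengthens \<open>s\<close> and strengthens the condition, and what was avoided before stays
  avoided by \<open>avoids_append\<close> and \<open>avoids_mono\<close>. There are finitely many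
  segments of length \<open>k\<close>, so \<open>us\<close> can list them all.\<close>

lemma avoids_block_exists:
  assumes nwd: "forces R p (nowhere_dense_fm R Z)" and q: "(q, p) \<in> R"
  obtains r s where "(r, q) \<in> R" "avoids Z r k s"
proof -
  have "\<exists>r s. (r, q) \<in> R \<and> (\<forall>u\<in>set us. avoids Z r 0 (u @ s))" for us
  proof (induction us)
    case Nil
    then show ?case using refl_left[OF q] by auto
  next
    case (Cons u us)
    then obtain r s where r: "(r, q) \<in> R" "\<forall>u\<in>set us. avoids Z r 0 (u @ s)" by blast
    have "(r, p) \<in> R" using r q trans by blast
    then obtain r' s' where r': "(r', r) \<in> R" "avoids Z r' 0 ((u @ s) @ s')"
      using avoids_extension[OF nwd] by metis
    have "avoids Z r' 0 (u' @ s @ s')" if "u' \<in> set us" for u'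
    proof -
      have "avoids Z r 0 (u' @ s)" using r(2) that by blast
      then have "avoids Z r' 0 ((u' @ s) @ s')"
        by (rule avoids_append[OF avoids_mono[OF _ r'(1)]])
      then show ?thesis by simp
    qed
    then show ?case
      using r r' trans by (intro exI[of _ r'] exI[of _ "s @ s'"]) auto
  qed
  note ex = this
  obtain us where us: "set us = {u :: bool list. length u = k}"
    using finite_list[of "{u :: bool list. length u = k}"]
      finite_lists_length_eq[of "UNIV :: bool set" k] by auto
  obtain r s where r: "(r, q) \<in> R" "\<And>u. length u = k \<Longrightarrow> avoids Z r 0 (u @ s)"
    using ex[of us] unfolding us by blast
  \<comment> \<open>An element of \<open>Z\<close> containing \<open>s\<close> at \<open>k\<close>
    has, below some extension, a decided restriction \<open>u\<close> to \<open>k\<close>, and then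
    it extends \<open>u @ s\<close>.\<close>
  have "avoids Z r k s"
    unfolding avoids_def
  proof (intro allI impI notI)
    fix t z assume t: "(t, r) \<in> R" "is_name R z" "forces_mem R z Z t" "forces_block t z k s"
    have "(t, p) \<in> R" using t r q trans by blast
    then obtain t' u where t': "(t', t) \<in> R" "length u = k" "forces_block t' z 0 u"
      using forces_real_decide[OF nowhere_dense_real[OF nwd _ t(2,3)] refl_left[OF t(1)]] by metis
    then have "forces_block t' z 0 (u @ s)"
      using t forces_block_mono unfolding forces_block_append by auto
    moreover have "avoids Z r 0 (u @ s)" using r(2) t' by blast
    ultimately show False
      using t t' trans forces_mem_mono unfolding avoids_def by meson
  qed
  then show thesis using that r by blast
qed

text \<open>Letting each block start where the previous one ends makes the sequence recoverable from
  the start \<open>k\<close> and a list of lists, which has a natural number as code.\<close>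

primrec avoids_seq :: "('p, 'i) name \<Rightarrow> 'p \<Rightarrow> nat \<Rightarrow> bool list list \<Rightarrow> bool" where
  "avoids_seq Z p k [] \<longleftrightarrow> True"
| "avoids_seq Z p k (s # ss) \<longleftrightarrow> avoids Z p k s \<and> avoids_seq Z p (k + length s) ss"

lemma avoids_seq_mono: "avoids_seq Z p k ss \<Longrightarrow> (q, p) \<in> R \<Longrightarrow> avoids_seq Z q k ss"
  by (induction ss arbitrary: k) (auto intro: avoids_mono)

lemma avoids_seq_exists:
  assumes nwd: "forces R p (nowhere_dense_fm R Z)" and q: "(q, p) \<in> R"
  shows "\<exists>r ss. (r, q) \<in> R \<and> length ss = n \<and> avoids_seq Z r k ss"
  using q
proof (induction n arbitrary: q k)
  case 0
  then show ?case using refl_left by fastforce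
next
  case (Suc n)
  obtain r s where r: "(r, q) \<in> R" "avoids Z r k s"
    using avoids_block_exists[OF nwd Suc.prems] by blast
  then obtain r' ss where r': "(r', r) \<in> R" "length ss = n" "avoids_seq Z r' (k + length s) ss"
    using Suc.IH Suc.prems trans by meson
  then have "avoids_seq Z r' k (s # ss)" "length (s # ss) = Suc n" "(r', q) \<in> R"
    using r avoids_mono trans by auto
  then show ?case by blast
qed

text \<open>
  Among the candidates, one whose first block ends earliest goes first; the second blocks of all
  the others begin only after it has ended.
\<close>
lemma avoids_common_block:
  assumes "finite X" "card X \<le> n" "\<forall>(k', ss)\<in>X. k \<le> k' \<and> n \<le> length ss"
  shows "\<exists>s. \<forall>(k', ss)\<in>X. \<forall>p. avoids_seq Z p k' ss \<longrightarrow> avoids Z p k s"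
  using assms
proof (induction n arbitrary: X k)
  case 0
  then show ?case by auto
next
  case (Suc n)
  show ?case
  proof (cases "X = {}")
    case False
    define stop :: "nat \<times> bool list list \<Rightarrow> nat" where "stop = (\<lambda>(k', ss). k' + length (hd ss))"
    obtain x where x: "x \<in> X" "\<And>y. y \<in> X \<Longrightarrow> stop x \<le> stop y"
      using ex_min_if_finite[of "stop ` X"] Suc.prems(1) False by (auto simp: not_less)
    obtain kx sx where [simp]: "x = (kx, sx)" by (cases x)
    \<comment> \<open>Removing \<open>x\<close> leaves at most \<open>n\<close> candidates; each of
      them gives up its first block and keeps at least \<open>n\<close>, all starting at or after
      \<open>stop x\<close>. So the induction hypothesis applies at \<open>stop x\<close>.\<close>
    let ?next = "\<lambda>(k', ss). (k' + length (hd ss), tl ss) :: nat \<times> bool list list"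
    let ?Y = "?next ` (X - {x})"
    have "card ?Y \<le> n"
      using card_image_le[of "X - {x}" ?next] Suc.prems(1,2) x(1) by simp
    moreover have "\<forall>(k', ss)\<in>?Y. stop x \<le> k' \<and> n \<le> length ss"
      using x(2) Suc.prems(3) by (fastforce simp: stop_def)
    ultimately obtain s where s: "\<forall>(k', ss)\<in>?Y. \<forall>p. avoids_seq Z p k' ss \<longrightarrow> avoids Z p (stop x) s"
      using Suc.IH[of ?Y "stop x"] Suc.prems(1) by blast
    have kx: "k \<le> kx" "sx \<noteq> []" using Suc.prems(3) x(1) by auto
    \<comment> \<open>Filler up to \<open>kx\<close>, where the first block of \<open>x\<close>
      begins; its values are arbitrary.\<close>
    let ?a = "replicate (kx - k) False"
    have len: "k + length (?a @ hd sx) = stop x" "k + length ?a = kx"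
      using kx by (auto simp: stop_def)
    have "avoids Z p k (?a @ hd sx @ s)" if y: "(k', ss) \<in> X" "avoids_seq Z p k' ss" for k' ss p
    proof -
      obtain s0 ss' where ss: "ss = s0 # ss'" using Suc.prems(3) y(1) by (cases ss) auto
      show ?thesis
      proof (cases "(k', ss) = x")
        case True
        then have "avoids Z p (k + length ?a) (hd sx)" using y(2) ss len by auto
        then show ?thesis by (intro avoids_prepend avoids_append)
      next
        case False
        then have "?next (k', ss) \<in> ?Y" using y(1) by (intro imageI) simp
        then have "avoids_seq Z p (k' + length (hd ss)) (tl ss) \<longrightarrow> avoids Z p (stop x) s"
          using bspec[OF s] by fastforce
        then have "avoids Z p (stop x) s" using y(2) ss by simp
        then show ?thesis using avoids_prepend[of Z p k "?a @ hd sx" s] len by simp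
      qed
    qed
    then show ?thesis by blast
  qed simp
qed


section \<open>The Weak Sacks Property\<close>

text \<open>The property is applied with the identity for \<open>g\<close>: at \<open>n\<close>
  there are at most \<open>n\<close> candidate sequences of \<open>n\<close> blocks each, the
  balance that \<open>avoids_common_block\<close> needs.\<close>

lemma weak_sacks_avoids:
  fixes Z :: "('p, 'j) name"
  assumes ws: "weak_sacks TYPE('j) R" and p: "p \<in> Field R"
    and nwd: "forces R p (nowhere_dense_fm R Z)"
  obtains q A s where "(q, p) \<in> R" "infinite A" "\<And>n. n \<in> A \<Longrightarrow> avoids Z q n (s n)"
proof -
  define good where "good n m r \<longleftrightarrow>
      length (from_nat m :: bool list list) = n \<and> avoids_seq Z r n (from_nat m)" for n m r
  \<comment> \<open>Taking the least good code as the value at \<open>n\<close> makes conditions that decide different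
    values incompatible.\<close>
  define D where "D n m = {r \<in> Field R. good n m r \<and> (\<forall>m'<m. \<forall>t. (t, r) \<in> R \<longrightarrow> \<not> good n m' t)}"
    for n m
  have good_mono: "good n m t" if "good n m r" "(t, r) \<in> R" for n m r t
    using that avoids_seq_mono by (auto simp: good_def)
  let ?f = "fn_name D :: ('p, 'j) name"
  have openD: "r \<in> D n m" if "q \<in> D n m" "(r, q) \<in> R" for n m q r
    unfolding D_def using that(1) good_mono[OF _ that(2)] FieldI1[OF that(2)] trans[OF _ that(2)]
    by (simp add: D_def)
  have disj: "m = m'" if "q \<in> D n m" "q \<in> D n m'" for n m m' q
    using that refl by (cases m m' rule: linorder_cases) (auto simp: D_def)
  have dense: "\<exists>r m. (r, q) \<in> R \<and> r \<in> D n m" if q: "(q, p) \<in> R" for n q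
  proof -
    obtain r ss where "(r, q) \<in> R" "length ss = n" "avoids_seq Z r n ss"
      using avoids_seq_exists[OF nwd q] by blast
    then have "\<exists>m r. (r, q) \<in> R \<and> good n m r"
      by (intro exI[of _ "to_nat ss"] exI[of _ r]) (simp add: good_def)
    \<comment> \<open>The least code that is good somewhere below \<open>q\<close>. No smaller code
      is good at any condition under an \<open>r\<close> below \<open>q\<close>, so a good
      \<open>r\<close> lies in \<open>D n m\<close>.\<close>
    then obtain m where m: "\<exists>r. (r, q) \<in> R \<and> good n m r"
        "\<And>m'. m' < m \<Longrightarrow> \<not> (\<exists>r. (r, q) \<in> R \<and> good n m' r)"
      using exists_least_iff[of "\<lambda>m. \<exists>r. (r, q) \<in> R \<and> good n m r"] by blast
    then obtain r where r: "(r, q) \<in> R" "good n m r" by blast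
    then have "r \<in> D n m"
      using m(2) trans[OF _ r(1)] FieldI1[OF r(1)] by (auto simp: D_def)
    then show ?thesis using r(1) by blast
  qed
  have fun_f: "forces R p (fun_fm R ?f (omega R) (omega R))"
    by (rule forces_fun_fn_name) (use openD disj dense in auto)
  have name_f: "is_name R ?f"
    by (rule is_name_fn_name) (auto simp: D_def)
  obtain q F A where q: "(q, p) \<in> R" "\<And>n. finite (F n) \<and> card (F n) = n" "infinite A"
    "forces R q (ForallN A (\<lambda>n. Exists_in (chk_set R (F n)) (\<lambda>m. Mem (opair R (chk R n) m) ?f)))"
    using ws[unfolded weak_sacks_def, THEN bspec, OF p, THEN spec, of ?f, THEN spec,
        of "\<lambda>n. n", THEN mp, OF conjI[OF name_f conjI[OF fun_f filterlim_ident]]] by blast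
  \<comment> \<open>Numbers in \<open>F n\<close> that do not code a list of length \<open>n\<close>
    are dropped; the value of \<open>?f\<close> at \<open>n\<close> is never one of them.\<close>
  define X where "X n = (\<lambda>m. (n, from_nat m :: bool list list)) ` F n \<inter> {(k, ss). length ss = n}" for n
  have "\<exists>s. \<forall>(k', ss)\<in>X n. \<forall>p. avoids_seq Z p k' ss \<longrightarrow> avoids Z p n s" for n
  proof (rule avoids_common_block)
    show "finite (X n)" using q(2) by (simp add: X_def)
    have "card (X n) \<le> card ((\<lambda>m. (n, from_nat m :: bool list list)) ` F n)"
      using q(2) by (intro card_mono) (auto simp: X_def)
    then show "card (X n) \<le> n"
      using card_image_le[of "F n" "\<lambda>m. (n, from_nat m :: bool list list)"] q(2) by fastforce
  qed (auto simp: X_def)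
  then obtain s where s: "\<And>n k' ss p. (k', ss) \<in> X n \<Longrightarrow> avoids_seq Z p k' ss \<Longrightarrow> avoids Z p n (s n)"
    by (metis (mono_tags, lifting) case_prodD)
  have "avoids Z q n (s n)" if n: "n \<in> A" for n
  proof (rule avoids_regular)
    \<comment> \<open>Densely below \<open>q\<close>, the value of \<open>?f\<close> at
      \<open>n\<close> is decided to be some \<open>m\<close> in \<open>F n\<close>; since this code
      is good, the common block \<open>s n\<close> avoids \<open>Z\<close>.\<close>
    fix q' assume q': "(q', q) \<in> R"
    have "forces R q (Exists_in (chk_set R (F n)) (\<lambda>m. Mem (opair R (chk R n) m) ?f))"
      using q(4) n by simp
    then obtain r y where r: "(r, q') \<in> R" "forces_mem R y (chk_set R (F n)) r"
        "forces_mem R (opair R (chk R n) y) ?f r"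
      using q' unfolding forces_Exists_in by auto
    obtain r1 m where r1: "(r1, r) \<in> R" "m \<in> F n" "forces_eq R y (chk R m) r1"
      using r refl_left unfolding forces_mem_chk_set by blast
    obtain r2 t n' m' where r2: "(r2, r1) \<in> R" "(r2, t) \<in> R" "t \<in> D n' m'"
        "forces_eq R (chk R n :: ('p, 'j) name) (chk R n') r2" "forces_eq R y (chk R m') r2"
      by (rule forces_mem_fn_name[OF r(3) r1(1)])
    have r2F: "r2 \<in> Field R" by (rule FieldI1[OF r2(1)])
    have "n = n'" by (rule forces_eq_chk[OF r2(4) r2F])
    moreover have "m = m'"
      by (rule forces_eq_chk_unique[OF forces_eq_mono[OF r1(3) r2(1)] r2(5) r2F])
    ultimately have "good n m r2" using openD[OF r2(3,2)] by (simp add: D_def)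
    then have "avoids Z r2 n (s n)"
      using s[of n "from_nat m" n r2] r1(2) by (auto simp: good_def X_def)
    then show "\<exists>r. (r, q') \<in> R \<and> avoids Z r n (s n)"
      using r r1 r2 trans by blast
  qed
  then show thesis using that q by blast
qed

end


section \<open>The forcing notion of an ideal and its iterations\<close>

text \<open>For an empty interval the bounds \<open>d \<le> n\<close> leave only
  \<open>d = n\<close>, so the start is determined in this case too. This is what makes
  \<open>d_of\<close> well defined.\<close>

lemma interval_start_unique:
  assumes "d \<le> n" "d' \<le> n" "{d..<n} = {d'..<n}"
  shows "d = (d' :: nat)"
  using assms by (metis atLeastLessThan_empty_iff atLeastLessThan_eq_iff le_antisym not_less)

lemma d_of_eqI:
  assumes "\<And>n. d n \<le> n" "\<And>n. dom (\<sigma> n) = {d n..<n}"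
  shows "d_of \<sigma> = d"
  unfolding d_of_def
proof (rule the_equality)
  show "d' = d" if "\<forall>n. d' n \<le> n \<and> dom (\<sigma> n) = {d' n..<n}" for d'
  proof
    fix n show "d' n = d n"
      by (rule interval_start_unique[of _ n]) (use assms that in auto)
  qed
qed (use assms in auto)

lemma ideal_conds_d_of:
  assumes "\<sigma> \<in> ideal_conds I"
  shows "d_of \<sigma> n \<le> n" "dom (\<sigma> n) = {d_of \<sigma> n..<n}" "d_of \<sigma> -` {n} \<in> I"
proof -
  obtain d where "\<And>n. d n \<le> n" "\<And>n. dom (\<sigma> n) = {d n..<n}" "\<And>n. d -` {n} \<in> I"
    using assms unfolding ideal_conds_def by blast
  then show "d_of \<sigma> n \<le> n" "dom (\<sigma> n) = {d_of \<sigma> n..<n}" "d_of \<sigma> -` {n} \<in> I"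
    using d_of_eqI by metis+
qed

lemma ideal_forcing_refl: "\<sigma> \<in> ideal_conds I \<Longrightarrow> (\<sigma>, \<sigma>) \<in> ideal_forcing I"
  unfolding ideal_forcing_def by (auto intro!: exI[of _ id])

lemma Field_ideal_forcing: "Field (ideal_forcing I) = ideal_conds I"
  using ideal_forcing_refl by (auto simp: Field_def ideal_forcing_def)

text \<open>For the agreement clause, the interval from \<open>d_of \<sigma> n\<close> to
  \<open>d_of \<rho> n\<close> is split at \<open>d_of \<tau> n\<close>, which is the same for
  \<open>n\<close> and \<open>m\<close> because it is a function of \<open>d_of \<rho> n\<close>.
  The lower part is the clause for \<sigma> below \<tau>; the upper part is the clause for \<tau>
  below \<rho>, whose values \<sigma> inherits.\<close>

lemma ideal_forcing_trans:
  assumes \<sigma>: "(\<sigma>, \<tau>) \<in> ideal_forcing I" and \<tau>: "(\<tau>, \<rho>) \<in> ideal_forcing I"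
  shows "(\<sigma>, \<rho>) \<in> ideal_forcing I"
proof -
  obtain e where e: "\<And>n. e n \<le> n" "d_of \<sigma> = e \<circ> d_of \<tau>"
    using \<sigma> unfolding ideal_forcing_def by blast
  obtain e' where e': "\<And>n. e' n \<le> n" "d_of \<tau> = e' \<circ> d_of \<rho>"
    using \<tau> unfolding ideal_forcing_def by blast
  have conds: "\<sigma> \<in> ideal_conds I" "\<tau> \<in> ideal_conds I" "\<rho> \<in> ideal_conds I"
    and ext: "\<And>n. \<tau> n \<subseteq>\<^sub>m \<sigma> n" "\<And>n. \<rho> n \<subseteq>\<^sub>m \<tau> n"
    using \<sigma> \<tau> unfolding ideal_forcing_def by auto
  have "\<sigma> n i = \<sigma> m i" if nm: "d_of \<rho> n = d_of \<rho> m" and i: "d_of \<sigma> n \<le> i" "i < d_of \<rho> n" for n m i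
  proof -
    have dnm: "d_of \<tau> n = d_of \<tau> m" using nm e' by simp
    show ?thesis
    proof (cases "i < d_of \<tau> n")
      case True
      have "\<sigma> n |` {d_of \<sigma> n..<d_of \<tau> n} = \<sigma> m |` {d_of \<sigma> n..<d_of \<tau> n}"
        using \<sigma> dnm unfolding ideal_forcing_def by blast
      then show ?thesis using True i by (auto simp: restrict_map_def fun_eq_iff split: if_splits)
    next
      case False
      have "\<tau> n |` {d_of \<tau> n..<d_of \<rho> n} = \<tau> m |` {d_of \<tau> n..<d_of \<rho> n}"
        using \<tau> nm unfolding ideal_forcing_def by blast
      then have "\<tau> n i = \<tau> m i"
        using False i by (auto simp: restrict_map_def fun_eq_iff split: if_splits)
      moreover have "i \<in> dom (\<tau> n)" "i \<in> dom (\<tau> m)"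
        using False i dnm nm ideal_conds_d_of(1)[OF conds(3), of n] ideal_conds_d_of(1)[OF conds(3), of m]
        by (auto simp: ideal_conds_d_of(2)[OF conds(2)])
      ultimately show ?thesis using ext(1) by (metis map_le_def)
    qed
  qed
  then have "\<forall>n m. d_of \<rho> n = d_of \<rho> m \<longrightarrow>
      \<sigma> n |` {d_of \<sigma> n..<d_of \<rho> n} = \<sigma> m |` {d_of \<sigma> n..<d_of \<rho> n}"
    by (auto simp: restrict_map_def fun_eq_iff)
  moreover have "\<forall>n. \<rho> n \<subseteq>\<^sub>m \<sigma> n" using ext map_le_trans by blast
  moreover have "(\<forall>n. (e \<circ> e') n \<le> n) \<and> d_of \<sigma> = (e \<circ> e') \<circ> d_of \<rho>"
    using e e' by (metis comp_apply comp_assoc le_trans)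
  ultimately show ?thesis
    using conds unfolding ideal_forcing_def by blast
qed

lemma forcing_preorder_ideal_forcing: "forcing_preorder (ideal_forcing I)"
  by unfold_locales (auto simp: Field_ideal_forcing ideal_forcing_refl intro: ideal_forcing_trans)

section \<open>Two-step iterations as preorders\<close>

context forcing_preorder
begin

lemma is_name_two_step_conds:
  assumes "is_name R Q" "(p, x) \<in> two_step_conds R Q"
  shows "is_name R x"
proof -
  have "x \<in> fst ` elts Q" using assms(2) by (auto simp: two_step_conds_def)
  then obtain i A where "entries Q i = Some (x, A)"
    by (auto simp: elts_def)
  then show ?thesis using assms(1) by (auto elim: is_name.cases)
qed

text \<open>Reflexivity of the order named by \<open>L\<close> is forced by every condition. The
  lemma gives reflexivity of the iteration and, in the final proof, strengthening of the first
  coordinate alone.\<close>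

lemma two_step_le_same:
  assumes fn: "forcing_notion_name R Q L"
    and x: "(p, x) \<in> two_step_conds R Q" and q: "(q, p) \<in> R"
  shows "((q, x), (p, x)) \<in> two_step R Q L"
proof -
  have name: "is_name R x"
    using is_name_two_step_conds x fn unfolding forcing_notion_name_def by blast
  have qF: "q \<in> Field R" using q FieldI1 by metis
  have mem: "forces_mem R x Q q"
    using x q forces_mem_mono by (auto simp: two_step_conds_def)
  have "forces R q (Forall_in Q (\<lambda>x. Mem (opair R x x) L))"
    using fn qF unfolding forcing_notion_name_def forcing_notion_fm_def by simp
  then have "forces R q (Mem (opair R x x) L)"
    using name mem refl[OF qF] unfolding forces_Forall_in by blast
  then show ?thesis
    using x q mem qF by (auto simp: two_step_def two_step_conds_def)
qed

lemma Field_two_step: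
  assumes "forcing_notion_name R Q L"
  shows "Field (two_step R Q L) = two_step_conds R Q"
proof
  show "Field (two_step R Q L) \<subseteq> two_step_conds R Q"
    by (auto simp: Field_def two_step_def)
  show "two_step_conds R Q \<subseteq> Field (two_step R Q L)"
  proof
    fix c assume c: "c \<in> two_step_conds R Q"
    then have "(fst c, fst c) \<in> R" using refl by (auto simp: two_step_conds_def)
    then show "c \<in> Field (two_step R Q L)"
      using two_step_le_same[OF assms, of "fst c" "snd c" "fst c"] c by (auto intro: FieldI1)
  qed
qed

lemma forcing_preorder_two_step:
  assumes fn: "forcing_notion_name R Q L"
  shows "forcing_preorder (two_step R Q L)"
proof
  fix c assume "c \<in> Field (two_step R Q L)"
  then show "(c, c) \<in> two_step R Q L"
    using two_step_le_same[OF fn, of "fst c" "snd c" "fst c"] refl Field_two_step[OF fn]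
    by (auto simp: two_step_conds_def)
next
  fix a b c assume ab: "(a, b) \<in> two_step R Q L" and bc: "(b, c) \<in> two_step R Q L"
  obtain p x q y r z where [simp]: "a = (p, x)" "b = (q, y)" "c = (r, z)"
    by (cases a, cases b, cases c)
  have conds: "(p, x) \<in> two_step_conds R Q" "(q, y) \<in> two_step_conds R Q" "(r, z) \<in> two_step_conds R Q"
    and le: "(p, q) \<in> R" "(q, r) \<in> R"
    and L: "forces_mem R (opair R x y) L p" "forces_mem R (opair R y z) L q"
    using ab bc by (auto simp: two_step_def)
  have pF: "p \<in> Field R" and pr: "(p, r) \<in> R" using le trans FieldI1 by metis+
  have names: "is_name R x" "is_name R y" "is_name R z"
    using is_name_two_step_conds conds fn unfolding forcing_notion_name_def by blast+
  have mems: "forces_mem R x Q p" "forces_mem R y Q p" "forces_mem R z Q p"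
    using conds le pr forces_mem_mono by (auto simp: two_step_conds_def)
  have "forces R p (Forall_in Q (\<lambda>x. Forall_in Q (\<lambda>y. Forall_in Q (\<lambda>z.
             Imp (Conj (Mem (opair R x y) L) (Mem (opair R y z) L)) (Mem (opair R x z) L)))))"
    using fn pF unfolding forcing_notion_name_def forcing_notion_fm_def by simp
  then have "forces R p (Imp (Conj (Mem (opair R x y) L) (Mem (opair R y z) L)) (Mem (opair R x z) L))"
    using names mems refl[OF pF] unfolding forces_Forall_in by meson
  then have "forces R p (Mem (opair R x z) L)"
    using L(1) forces_mem_mono[OF L(2) le(1)] refl[OF pF] unfolding forces_Imp by simp
  then show "(a, c) \<in> two_step R Q L"
    using conds pr by (simp add: two_step_def)
qed

end

section \<open>The name for the real \<open>F_G(n)\<close>\<close>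

lemma is_name_FG_name:
  assumes "forcing_preorder R"
  shows "is_name R (FG_name R n)"
proof -
  interpret forcing_preorder R by fact
  show ?thesis
    by (rule is_name.intros)
      (auto simp: FG_name_def is_name_chk intro!: is_name_opair split: sum.splits prod.splits)
qed

text \<open>With \<open>p\<close> itself attached to the bit, \<open>forces_mem_elts\<close> turns
  every bit fixed by the first coordinate of \<open>p\<close> into a forced one.\<close>

lemma elts_FG_name:
  assumes "p \<in> Field R" "j < n" "fst p n j = Some b"
  shows "(opair R (chk R j) (chk R (of_bool b)), p) \<in> elts (FG_name R n)"
proof -
  let ?A = "{p \<in> Field R. map_option of_bool (fst p n j) = Some (of_bool b :: nat)}"
  have "entries (FG_name R n) (Inl (prod_encode (j, of_bool b))) =
      Some (opair R (chk R j) (chk R (of_bool b)), ?A)"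
    using assms(2) by (simp add: FG_name_def)
  moreover have "p \<in> ?A" using assms by simp
  ultimately show ?thesis unfolding elts_def by blast
qed

section \<open>Extending a condition by prescribed blocks\<close>

lemma ideal_bounded_vimage:
  assumes I: "ideal_on_omega I" and d: "\<And>n. d -` {n} \<in> I"
  shows "d -` {..<N :: nat} \<in> I"
proof (induction N)
  case 0
  then show ?case using I by (simp add: ideal_on_omega_def)
next
  case (Suc N)
  have "d -` {..<Suc N} = d -` {..<N} \<union> d -` {N}" by (auto simp: less_Suc_eq)
  then show ?case using Suc d I unfolding ideal_on_omega_def by metis
qed

text \<open>Both the new start \<open>e (d_of \<tau> n)\<close> and the new values depend on
  \<open>n\<close> only through \<open>d_of \<tau> n\<close>; this gives the factorisation and the
  agreement required of an extension. The fibres stay in the ideal because \<open>e\<close> is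
  finite-to-one.\<close>

lemma ideal_forcing_absorb_blocks:
  fixes s :: "nat \<Rightarrow> bool list"
  assumes I: "ideal_on_omega I" and \<tau>: "\<tau> \<in> ideal_conds I" and A: "infinite A"
  obtains \<sigma> U where "(\<sigma>, \<tau>) \<in> ideal_forcing I" "U \<in> dual_filter I"
    "\<And>n. n \<in> U \<Longrightarrow> \<exists>a\<in>A. a + length (s a) \<le> n \<and> (\<forall>i<length (s a). \<sigma> n (a + i) = Some (s a ! i))"
proof
  let ?d = "d_of \<tau>"
  note d = ideal_conds_d_of[OF \<tau>]
  define fits where "fits j = {a \<in> A. a + length (s a) \<le> j}" for j
  \<comment> \<open>If no block ends by \<open>j\<close>, nothing is added: the default
    \<open>e j = j\<close> leaves the domain as it is.\<close>
  define e where "e j = (if fits j = {} then j else Max (fits j))" for j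
  \<comment> \<open>From \<open>a = e (?d n)\<close> on, the block \<open>s a\<close> is copied; the
    length test in the conjunction fills the rest of the gap up to \<open>?d n\<close> with
    \<open>False\<close>.\<close>
  define \<sigma> where "\<sigma> n i =
      (if ?d n \<le> i then \<tau> n i
       else if e (?d n) \<le> i then Some (i - e (?d n) < length (s (e (?d n))) \<and> s (e (?d n)) ! (i - e (?d n)))
       else None)" for n i
  define U where "U = {n. fits (?d n) \<noteq> {}}"
  have fin: "finite (fits j)" for j
    by (rule finite_subset[of _ "{..j}"]) (auto simp: fits_def)
  have e_in: "e j \<in> fits j" if "fits j \<noteq> {}" for j
    using Max_in[OF fin that] that by (simp add: e_def)
  have e_le: "e j \<le> j" for j
    using e_in[of j] by (cases "fits j = {}") (auto simp: e_def fits_def)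
  \<comment> \<open>An \<open>a\<close> in \<open>A\<close> above \<open>m\<close> fits below every
    large \<open>j\<close>, and then \<open>e j\<close> is at least \<open>a\<close>.\<close>
  have e_bound: "\<exists>N. \<forall>j. e j = m \<longrightarrow> j < N" for m
  proof -
    obtain a where a: "a \<in> A" "m < a" using A finite_nat_set_iff_bounded_le by (metis not_less)
    have "j < Suc m + a + length (s a)" if "e j = m" for j
    proof (rule ccontr)
      assume "\<not> j < Suc m + a + length (s a)"
      then have "a \<in> fits j" using a by (simp add: fits_def)
      then have "a \<le> e j" using Max_ge[OF fin] by (auto simp: e_def)
      then show False using that a by simp
    qed
    then show ?thesis by blast
  qed
  have dom: "dom (\<sigma> n) = {e (?d n)..<n}" for n
  proof -
    have "i \<in> dom (\<sigma> n) \<longleftrightarrow> e (?d n) \<le> i \<and> i < n" for i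
      using d(1)[of n] d(2)[of n] e_le[of "?d n"]
      by (cases "?d n \<le> i") (auto simp: \<sigma>_def dom_def set_eq_iff)
    then show ?thesis by (intro set_eqI) simp
  qed
  have e_d: "e (?d n) \<le> n" for n using e_le[of "?d n"] d(1)[of n] by simp
  have d\<sigma>: "d_of \<sigma> = (\<lambda>n. e (?d n))"
    by (rule d_of_eqI) (use dom e_d in auto)
  have "(\<lambda>n. e (?d n)) -` {m} \<in> I" for m
  proof -
    \<comment> \<open>A fibre of the new start lies over boundedly many values of \<open>?d\<close>,
      hence inside a finite union of fibres of \<open>?d\<close>.\<close>
    obtain N where "\<forall>j. e j = m \<longrightarrow> j < N" using e_bound by blast
    then have "(\<lambda>n. e (?d n)) -` {m} \<subseteq> ?d -` {..<N}" by auto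
    then show ?thesis
      using ideal_bounded_vimage[OF I d(3)] I unfolding ideal_on_omega_def by meson
  qed
  then have "\<sigma> \<in> ideal_conds I"
    unfolding ideal_conds_def using dom e_d by (intro CollectI exI[of _ "\<lambda>n. e (?d n)"]) simp
  moreover have "\<forall>n. \<tau> n \<subseteq>\<^sub>m \<sigma> n"
    using d(2) by (auto simp: map_le_def \<sigma>_def)
  moreover have "\<sigma> n |` {d_of \<sigma> n..<?d n} = \<sigma> m |` {d_of \<sigma> n..<?d n}" if "?d n = ?d m" for n m
    using that by (auto simp: restrict_map_def fun_eq_iff d\<sigma> \<sigma>_def)
  moreover have "(\<forall>n. e n \<le> n) \<and> d_of \<sigma> = e \<circ> ?d" using e_le d\<sigma> by auto
  ultimately show "(\<sigma>, \<tau>) \<in> ideal_forcing I"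
    using \<tau> unfolding ideal_forcing_def by blast
  \<comment> \<open>One block is enough: an \<open>n\<close> outside \<open>U\<close> must have
    \<open>?d n\<close> below the end of this block.\<close>
  obtain a where "a \<in> A" using A by (metis ex_in_conv finite.emptyI)
  then have "UNIV - U \<subseteq> ?d -` {..<a + length (s a)}"
    by (auto simp: U_def fits_def not_le)
  then have "UNIV - U \<in> I"
    using ideal_bounded_vimage[OF I d(3)] I unfolding ideal_on_omega_def by meson
  then show "U \<in> dual_filter I"
    unfolding dual_filter_def by (intro CollectI exI[of _ "UNIV - U"]) auto
  show "\<exists>a\<in>A. a + length (s a) \<le> n \<and> (\<forall>i<length (s a). \<sigma> n (a + i) = Some (s a ! i))" if "n \<in> U" for n
  proof -
    have "e (?d n) \<in> fits (?d n)" using that e_in by (simp add: U_def)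
    then show ?thesis
      using d(1)[of n] by (intro bexI[of _ "e (?d n)"]) (auto simp: fits_def \<sigma>_def)
  qed
qed

theorem theorem2p17:
  fixes I :: "nat set set"
    and Q L :: "(cond, 'i) name"
    and \<tau> :: cond and p :: "(cond, 'i) name"
    and Z :: "(cond \<times> (cond, 'i) name, 'j) name"
  assumes "maximal_ideal_on_omega I"
    and "forcing_notion_name (ideal_forcing I) Q L"
    and "weak_sacks TYPE('j) (two_step (ideal_forcing I) Q L)"
    and "(\<tau>, p) \<in> two_step_conds (ideal_forcing I) Q"
    and "is_name (two_step (ideal_forcing I) Q L) Z"
    and "forces (two_step (ideal_forcing I) Q L) (\<tau>, p) (nowhere_dense_fm (two_step (ideal_forcing I) Q L) Z)"
  shows "\<exists>\<sigma> q U. ((\<sigma>, q), (\<tau>, p)) \<in> two_step (ideal_forcing I) Q L \<and> U \<in> dual_filter I \<and>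
           forces (two_step (ideal_forcing I) Q L) (\<sigma>, q) (FG_disjoint_fm (two_step (ideal_forcing I) Q L) U Z)"
proof -
  let ?P = "ideal_forcing I" and ?R = "two_step (ideal_forcing I) Q L"
  interpret P: forcing_preorder ?P by (rule forcing_preorder_ideal_forcing)
  interpret R: forcing_preorder ?R by (rule P.forcing_preorder_two_step) fact
  have "(\<tau>, p) \<in> Field ?R" using assms(2,4) P.Field_two_step by blast
  then obtain c A s where c: "(c, (\<tau>, p)) \<in> ?R" "infinite A" "\<And>n. n \<in> A \<Longrightarrow> R.avoids Z c n (s n)"
    using R.weak_sacks_avoids assms(3,6) by metis
  obtain \<tau>' q where [simp]: "c = (\<tau>', q)" by (cases c)
  have conds: "(\<tau>', q) \<in> two_step_conds ?P Q" using c(1) by (simp add: two_step_def)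
  then have "\<tau>' \<in> ideal_conds I" by (simp add: two_step_conds_def Field_ideal_forcing)
  moreover have "ideal_on_omega I" using assms(1) by (simp add: maximal_ideal_on_omega_def)
  ultimately obtain \<sigma> U where \<sigma>: "(\<sigma>, \<tau>') \<in> ?P" "U \<in> dual_filter I"
    "\<And>n. n \<in> U \<Longrightarrow> \<exists>a\<in>A. a + length (s a) \<le> n \<and> (\<forall>i<length (s a). \<sigma> n (a + i) = Some (s a ! i))"
    using ideal_forcing_absorb_blocks[OF _ _ c(2)] by metis
  \<comment> \<open>Only the first coordinate is strengthened further; what \<open>c\<close> forces
    about the blocks is inherited.\<close>
  have le: "((\<sigma>, q), c) \<in> ?R" using P.two_step_le_same[OF assms(2) conds \<sigma>(1)] by simp
  have "\<not> forces_mem ?R (FG_name ?R n) Z r" if n: "n \<in> U" and r: "(r, (\<sigma>, q)) \<in> ?R" for n r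
  proof
    assume mem: "forces_mem ?R (FG_name ?R n) Z r"
    obtain a where a: "a \<in> A" "a + length (s a) \<le> n"
        "\<And>i. i < length (s a) \<Longrightarrow> \<sigma> n (a + i) = Some (s a ! i)"
      using \<sigma>(3)[OF n] by blast
    have rF: "r \<in> Field ?R" using r FieldI1 by metis
    \<comment> \<open>The block \<open>s a\<close> lies in the first coordinate of \<open>r\<close>,
      so \<open>r\<close> forces the real named by \<open>FG_name\<close> to contain it, which
      \<open>avoids\<close> forbids for an element of \<open>Z\<close>. The bound
      \<open>a + length (s a) \<le> n\<close> keeps its bits below \<open>n\<close>, where the name
      reads them off the conditions.\<close>
    have "\<sigma> n \<subseteq>\<^sub>m fst r n"
      using r by (auto simp: two_step_def ideal_forcing_def)
    then have "fst r n (a + i) = Some (s a ! i)" if "i < length (s a)" for i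
      using a(3)[OF that] by (metis domI map_le_def)
    then have "R.forces_block r (FG_name ?R n) a (s a)"
      unfolding R.forces_block_def
      using a(2) rF by (intro allI impI R.forces_mem_elts[OF elts_FG_name R.refl]) auto
    moreover have "(r, c) \<in> ?R" using r le R.trans by blast
    ultimately show False
      using c(3)[OF a(1)] mem is_name_FG_name[OF R.forcing_preorder_axioms]
      unfolding R.avoids_def by blast
  qed
  then have "forces ?R (\<sigma>, q) (FG_disjoint_fm ?R U Z)"
    by (simp add: FG_disjoint_fm_def)
  moreover have "((\<sigma>, q), (\<tau>, p)) \<in> ?R" using le c(1) R.trans by blast
  ultimately show ?thesis using \<sigma>(2) by blast
qed

end
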